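(* Let $q=p^d$ with $p$ prime, let $G\le\mathrm{A\Gamma L}(1,q)$ be $2$-transitive on $\mathbb F_q$, and let $P$ be an imprimitive block of $G_0$ on $\mathbb F_q^\times$ containing $1$, with associated $H$, $K$, $e$, $T_1$, $T_2$ as in the context. Let $L=P\cup\{0\}$, and assume that $L$ is not a subfield of $\mathbb F_q$. Let $\mathcal D=(\mathbb F_q,L^G)$ and $\Omega=(0,L)^G$. Suppose that $1<|P|<q-1$ and $|T_i|=p^{c_i}$ for $i=1,2$. Then $\Gamma(\mathcal D,\Omega,\Xi)$ has $|H/K|\,e\,p^{d-c_1}/2$ connected components when $P\ne-P$, and $|H/K|\,e\,p^{d-c_2}$ connected components when $P=-P$. Therefore, $\Gamma(\mathcal D,\Omega,\Xi)$ is connected if and only if $p\equiv-1\pmod4$, $d$ is odd, and $P$ is the subgroup of $\mathbb F_q^\times$ of index $2$. Moreover, if $\Gamma(\mathcal D,\Omega,\Xi)$ is connected, then it has order $|\Omega|=2q$ and valency $(q-1)/2$.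
   Context: Elements of $\mathrm{A\Gamma L}(1,q)$ are the maps $\tau(a,c,\varphi):z\mapsto az^\varphi+c$ with $a\in\mathbb F_q^\times$, $c\in\mathbb F_q$, $\varphi\in\mathrm{Aut}(\mathbb F_q)=\langle\zeta\rangle$, $\zeta:z\mapsto z^p$; maps are composed from left to right. Put $t(a,j)=\tau(a,0,\zeta^j)$. $G_0$ is the stabilizer of $0$ and $G_{0,P}$ the setwise stabilizer of $P$ in $G_0$. An imprimitive block of $G_0$ on $\mathbb F_q^\times$ is a nonempty $P\subseteq\mathbb F_q^\times$ with $P^g=P$ or $P^g\cap P=\emptyset$ for all $g\in G_0$. Let $s$ be the smallest positive integer with $t(a,s)\in G_0$ for some $a\in\mathbb F_q^\times$, and $m$ the smallest positive integer with $t(1,ms)\in G_0$. $H=\{a:t(a,0)\in G_0\}$ and $K=\{a:t(a,0)\in G_{0,P}\}$ (subgroups of $\mathbb F_q^\times$), and $e$ is the smallest positive integer with $t(c,es)\in G_{0,P}$ for some $c\in\mathbb F_q^\times$; then $e\mid m$, $K\le H$, and $P=K\cup Kw^{[\psi,1]}\cup\cdots\cup Kw^{[\psi,m/e-1]}$ for any $t(w,es)\in G_{0,P}$, where $\psi=\zeta^{es}$ and $[\psi,i]=(p^{esi}-1)/(p^{es}-1)$. $-P=\{-a:a\in P\}$. $\widetilde T_1$ and $\widetilde T_2$ are the subgroups of $(\mathbb F_q,+)$ generated by $\{a-1:a\in P\}$ and $P$ respectively, and $T_i=\{\tau(1,c,\mathrm{id}):c\in\widetilde T_i\}$. $(\mathbb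 F_q,L^G)$ is the incidence structure with point set $\mathbb F_q$, block set $\{L^g:g\in G\}$, incidence by inclusion; $\Omega$ is a $G$-orbit on its flags (pairs (point, block) with the point in the block). $\Xi$ is the set of $((x,M),(y,N))\in\Omega\times\Omega$ with $x\neq y$ and $x,y\in M\cap N$, and $\Gamma(\mathcal D,\Omega,\Xi)$ is the graph with vertex set $\Omega$ and arc set $\Xi$. *)

theory Defs
  imports
    "HOL-Algebra.Algebra"
    "HOL-Algebra.Algebraic_Closure_Type"
    "HOL-Number_Theory.Cong"
    "Graph_Theory.Graph_Theory"
begin

text \<open>
  The finite field is a type of sort \<open>{field, finite}\<close>; \<open>Fq\<close> is the same field as a
  \<^verbatim>\<open>HOL-Algebra\<close> record, through which subfields, automorphisms and generated subgroups
  are taken from that library.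
\<close>

abbreviation Fq :: "'a::field ring" where
  "Fq \<equiv> ring_of_type_algebra"

abbreviation Fq_mult :: "'a::field monoid" where
  "Fq_mult \<equiv> mult_of Fq"


section \<open>The one-dimensional affine semilinear group\<close>

definition tau :: "'a::field \<Rightarrow> 'a \<Rightarrow> ('a \<Rightarrow> 'a) \<Rightarrow> 'a \<Rightarrow> 'a" where
  "tau a c \<phi> = (\<lambda>z. a * \<phi> z + c)"

text \<open>Maps are composed from left to right: in the product of \<open>f\<close> and \<open>g\<close>, \<open>f\<close> is applied first.\<close>

definition AGammaL1 :: "('a::field \<Rightarrow> 'a) monoid" where
  "AGammaL1 = \<lparr>carrier = {tau a c \<phi> | a c \<phi>. a \<noteq> 0 \<and> \<phi> \<in> ring_iso Fq Fq},
               monoid.mult = (\<lambda>f g. g \<circ> f), one = id\<rparr>"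

definition t_map :: "nat \<Rightarrow> 'a::field \<Rightarrow> nat \<Rightarrow> 'a \<Rightarrow> 'a" where
  "t_map p a j = tau a 0 ((\<lambda>z. z ^ p) ^^ j)"

definition two_transitive :: "('a \<Rightarrow> 'a) set \<Rightarrow> bool" where
  "two_transitive G \<longleftrightarrow>
     (\<forall>x y u v. x \<noteq> y \<longrightarrow> u \<noteq> v \<longrightarrow> (\<exists>g\<in>G. g x = u \<and> g y = v))"

definition stab0 :: "('a::zero \<Rightarrow> 'a) set \<Rightarrow> ('a \<Rightarrow> 'a) set" where
  "stab0 G = {g \<in> G. g 0 = 0}"

definition stab0_set :: "('a::zero \<Rightarrow> 'a) set \<Rightarrow> 'a set \<Rightarrow> ('a \<Rightarrow> 'a) set" where
  "stab0_set G P = {g \<in> stab0 G. g ` P = P}"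

definition imprimitive_block :: "('a::zero \<Rightarrow> 'a) set \<Rightarrow> 'a set \<Rightarrow> bool" where
  "imprimitive_block G0 P \<longleftrightarrow>
     P \<noteq> {} \<and> P \<subseteq> UNIV - {0} \<and> (\<forall>g\<in>G0. g ` P = P \<or> g ` P \<inter> P = {})"


section \<open>Parameters attached to a group and a block\<close>

definition H_grp :: "nat \<Rightarrow> ('a::field \<Rightarrow> 'a) set \<Rightarrow> 'a set" where
  "H_grp p G = {a. a \<noteq> 0 \<and> t_map p a 0 \<in> stab0 G}"

definition K_grp :: "nat \<Rightarrow> ('a::field \<Rightarrow> 'a) set \<Rightarrow> 'a set \<Rightarrow> 'a set" where
  "K_grp p G P = {a. a \<noteq> 0 \<and> t_map p a 0 \<in> stab0_set G P}"

definition s_num :: "nat \<Rightarrow> ('a::field \<Rightarrow> 'a) set \<Rightarrow> nat" where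
  "s_num p G = (LEAST s. 0 < s \<and> (\<exists>a. a \<noteq> 0 \<and> t_map p a s \<in> stab0 G))"

definition e_num :: "nat \<Rightarrow> ('a::field \<Rightarrow> 'a) set \<Rightarrow> 'a set \<Rightarrow> nat" where
  "e_num p G P =
     (LEAST e. 0 < e \<and> (\<exists>c. c \<noteq> 0 \<and> t_map p c (e * s_num p G) \<in> stab0_set G P))"

definition HK_order :: "nat \<Rightarrow> ('a::field \<Rightarrow> 'a) set \<Rightarrow> 'a set \<Rightarrow> nat" where
  "HK_order p G P = Coset.order ((Fq_mult\<lparr>carrier := H_grp p G\<rparr>) Mod K_grp p G P)"

definition T1_tilde :: "'a::field set \<Rightarrow> 'a set" where
  "T1_tilde P = generate (add_monoid Fq) {a - 1 | a. a \<in> P}"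

definition T2_tilde :: "'a::field set \<Rightarrow> 'a set" where
  "T2_tilde P = generate (add_monoid Fq) P"

definition translation_maps :: "'a::field set \<Rightarrow> ('a \<Rightarrow> 'a) set" where
  "translation_maps T = {tau 1 c id | c. c \<in> T}"


section \<open>The incidence structure, its flags, and the flag graph\<close>

text \<open>An incidence structure whose incidence is membership: its point set and its block set.\<close>

type_synonym 'a incidence_structure = "'a set \<times> 'a set set"

definition orbit_design :: "('a \<Rightarrow> 'a) set \<Rightarrow> 'a set \<Rightarrow> 'a incidence_structure" where
  "orbit_design G L = (UNIV, {g ` L | g. g \<in> G})"

definition flags :: "'a incidence_structure \<Rightarrow> ('a \<times> 'a set) set" where
  "flags D = {(x, M). x \<in> fst D \<and> M \<in> snd D \<and> x \<in> M}"

definition flag_orbit :: "('a \<Rightarrow> 'a) set \<Rightarrow> 'a \<times> 'a set \<Rightarrow> ('a \<times> 'a set) set" where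
  "flag_orbit G f = {(g (fst f), g ` snd f) | g. g \<in> G}"

lemma flag_orbit_subset_flags:
  "x \<in> L \<Longrightarrow> flag_orbit G (x, L) \<subseteq> flags (orbit_design G L)"
  by (auto simp: flag_orbit_def flags_def orbit_design_def)

definition Xi :: "('a \<times> 'a set) set \<Rightarrow> (('a \<times> 'a set) \<times> ('a \<times> 'a set)) set" where
  "Xi \<Omega> = {((x, M), (y, N)).
     (x, M) \<in> \<Omega> \<and> (y, N) \<in> \<Omega> \<and> x \<noteq> y \<and> x \<in> M \<inter> N \<and> y \<in> M \<inter> N}"

text \<open>
  As in the usual notation for flag graphs, the design is carried along as an argument,
  although the graph is determined by its vertex set and its arc set.
\<close>

definition flag_graph ::
  "'a incidence_structure \<Rightarrow> ('a \<times> 'a set) set \<Rightarrow> (('a \<times> 'a set) \<times> ('a \<times> 'a set)) set \<Rightarrow>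
   ('a \<times> 'a set, ('a \<times> 'a set) \<times> ('a \<times> 'a set)) pre_digraph" where
  "flag_graph D \<Omega> \<Xi> = with_proj \<lparr>pverts = \<Omega>, parcs = \<Xi>\<rparr>"

text \<open>
  An undirected graph is a symmetric digraph here, so its connected components are its
  strongly connected components and the valency of a vertex is its out-degree.
\<close>

lemma symmetric_flag_graph: "symmetric (flag_graph D \<Omega> (Xi \<Omega>))"
  by (auto simp: symmetric_def flag_graph_def Xi_def sym_def)

definition num_components :: "('v, 'e) pre_digraph \<Rightarrow> nat" where
  "num_components \<Gamma> = card (pre_digraph.sccs \<Gamma>)"

definition has_valency :: "('v, 'e) pre_digraph \<Rightarrow> real \<Rightarrow> bool" where
  "has_valency \<Gamma> k \<longleftrightarrow> (\<forall>v\<in>verts \<Gamma>. real (out_degree \<Gamma> v) = k)"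

end

theory Submission
  imports Defs "HOL-Number_Theory.Residues"
begin

text \<open>
  All of \<open>G\<close> is controlled by two facts.  First, every map in \<open>G\<close> has the form
  \<open>z \<mapsto> a z\<^bsup>p^j\<^esup> + c\<close>, because the Frobenius map generates the automorphisms of the field
  (\<open>automorphism_is_frob_power\<close>), and by counting linear parts \<open>G\<close> contains all translations
  (\<open>translation_mem\<close>).  Hence the flags in the orbit of \<open>(0, L)\<close> correspond to the pairs \<open>(x, A)\<close> of a
  field element and a block \<open>A\<close> of the block system \<open>P\<^sup>g\<close>, \<open>g \<in> G\<^sub>0\<close>; the flag of \<open>(x, A)\<close> is \<open>x\<close>
  together with \<open>x + (A \<union> {0})\<close>.  Second, \<open>-1\<close> is a scalar of \<open>G\<^sub>0\<close> (\<open>minus_1_scalar\<close>), so that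
  \<open>-A\<close> is again a block.

  In these coordinates \<open>(x, A)\<close> is adjacent exactly to the pairs \<open>(x + a, -A)\<close> with \<open>a \<in> A\<close>
  (\<open>flag_arc_iff\<close>).  Two steps change \<open>x\<close> by a difference of two elements of \<open>A\<close>, so the component of
  \<open>(x, A)\<close> consists of \<open>x + T\<close> over \<open>A\<close> and \<open>x + a + T\<close> over \<open>-A\<close>, where \<open>T\<close> is the additive span of
  \<open>A - A\<close> (\<open>flag_component\<close>).  If \<open>A \<noteq> -A\<close> these are disjoint and there are \<open>2 |T|\<close> flags; if
  \<open>A = -A\<close> they make up \<open>x\<close> plus the span of \<open>A\<close>.  The elements of \<open>G\<^sub>0\<close> are additive, so the sizes of the
  two spans are those for \<open>A = P\<close>.  All components thus have the same size, and dividing the number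
  \<open>q |H/K| e\<close> of flags by it gives the count; that there are \<open>|H/K| e\<close> blocks is the index of
  the stabilizer of \<open>P\<close> in \<open>G\<^sub>0\<close>, computed from scalars and Frobenius exponents (\<open>card_blocks\<close>).

  There are at least two blocks, so a single component requires \<open>P \<noteq> -P\<close>, exactly the two
  blocks \<open>P\<close> and \<open>-P\<close>, and \<open>|T\<^sub>1| = q\<close>.  Then \<open>-1\<close> does not stabilize \<open>P\<close>, and a comparison of the
  \<open>2\<close>-parts of \<open>(q - 1) / 2\<close> and \<open>d\<close> leaves only odd \<open>d\<close> and \<open>q \<equiv> 3 mod 4\<close>
  (\<open>half_block_imp\<close>); now the stabilizer of \<open>P\<close> has odd order and preserves the set of squares,
  whence \<open>P\<close> is that set (\<open>block_eq_squares\<close>).  Conversely, for the squares \<open>T\<^sub>1\<close> has more than \<open>q / 3\<close>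
  elements and is therefore the whole field (\<open>card_T1_tilde_half\<close>).
\<close>

section \<open>Finite fields and their automorphisms\<close>

lemma Fq_simps [simp]:
  "carrier Fq = UNIV" "\<one>\<^bsub>Fq\<^esub> = 1" "\<zero>\<^bsub>Fq\<^esub> = 0"
  "x \<otimes>\<^bsub>Fq\<^esub> y = x * y" "x \<oplus>\<^bsub>Fq\<^esub> y = x + y"
  by (simp_all add: ring_of_type_algebra_def)

lemma Fq_pow [simp]: "x [^]\<^bsub>Fq\<^esub> (n::nat) = (x::'a::field) ^ n"
proof -
  interpret field "Fq :: 'a ring" by (rule field_from_type_algebra)
  show ?thesis by (induction n) (auto simp: mult.commute)
qed

locale galois_field =
  fixes F :: "'a::{field,finite} itself" and p d q :: nat
  assumes prime_p: "Factorial_Ring.prime p" and q_eq: "q = p ^ d"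
    and card_F: "card (UNIV :: 'a set) = q"
begin

lemma CHAR_F: "CHAR('a) = p"
proof -
  have "Factorial_Ring.prime CHAR('a)"
    by (intro prime_CHAR_semidom finite_imp_CHAR_pos) simp
  moreover have "CHAR('a) dvd p ^ d"
    using CHAR_dvd_CARD[where 'a = 'a] card_F q_eq by simp
  ultimately show ?thesis
    using prime_p prime_dvd_power primes_dvd_imp_eq by blast
qed

lemma q_gt_1: "q > 1"
proof -
  have "card {0, 1 :: 'a} \<le> card (UNIV :: 'a set)" by (intro card_mono) auto
  then show ?thesis using card_F by simp
qed

lemma d_pos: "d > 0"
  using q_gt_1 q_eq by (cases d) auto

lemma p_gt_1: "p > 1"
  using prime_p by (rule prime_gt_1_nat)

lemma frob_add: "(x + y) ^ (p ^ j) = x ^ (p ^ j) + (y::'a) ^ (p ^ j)"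
  using freshmans_dream'[of "p ^ j" j x y] CHAR_F prime_p by simp

lemma frob_minus: "(- x) ^ (p ^ j) = - ((x::'a) ^ (p ^ j))"
proof -
  have "(- x) ^ (p ^ j) + x ^ (p ^ j) = 0"
    using frob_add[of "- x" x j] p_gt_1 by (simp add: power_0_left)
  then show ?thesis by (rule eq_neg_iff_add_eq_0[THEN iffD2])
qed

lemma frob_diff: "(x - y) ^ (p ^ j) = x ^ (p ^ j) - (y::'a) ^ (p ^ j)"
  using frob_add[of x "- y" j] frob_minus by simp

lemma inj_frob: "inj (\<lambda>x::'a. x ^ (p ^ j))"
proof (rule injI)
  fix x y :: 'a assume "x ^ (p ^ j) = y ^ (p ^ j)"
  then have "(x - y) ^ (p ^ j) = 0" by (simp add: frob_diff)
  then show "x = y" by simp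
qed

lemma surj_frob: "surj (\<lambda>x::'a. x ^ (p ^ j))"
  using inj_frob by (rule finite_UNIV_inj_surj[rotated]) simp

lemma power_q_minus_1: "x \<noteq> 0 \<Longrightarrow> (x::'a) ^ (q - 1) = 1"
proof -
  assume x: "x \<noteq> 0"
  have "\<Prod>(UNIV-{0::'a}) = (\<Prod>y\<in>UNIV-{0}. x * y)"
    by (rule prod.reindex_bij_witness[of _ "\<lambda>y. x * y" "\<lambda>y. y / x"]) (use x in auto)
  also have "\<dots> = x ^ (q - 1) * \<Prod>(UNIV-{0})"
    by (simp add: prod.distrib card_Diff_subset card_F)
  finally show ?thesis by simp
qed

lemma power_q: "(x::'a) ^ q = x"
proof (cases "x = 0")
  case False
  have "x ^ q = x ^ Suc (q - 1)" using q_gt_1 by simp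
  then show ?thesis using power_q_minus_1[OF False] by simp
qed (use q_gt_1 in auto)

lemma primitive_element: "\<exists>g::'a. \<forall>x. x \<noteq> 0 \<longrightarrow> (\<exists>i. x = g ^ i)"
proof -
  interpret field "Fq :: 'a ring" by (rule field_from_type_algebra)
  obtain g where g: "carrier (mult_of (Fq :: 'a ring)) = {g [^]\<^bsub>Fq\<^esub> i | i::nat. i \<in> UNIV}"
    using finite_field_mult_group_has_gen by auto
  then have "\<forall>x. x \<noteq> 0 \<longrightarrow> (\<exists>i. x = g ^ i)" by (auto simp: set_eq_iff)
  then show ?thesis ..
qed

lemma card_power_eq_le:
  assumes "n > 0"
  shows "card {x::'a. x ^ n = c} \<le> n"
proof -
  let ?f = "monom 1 n - [:c:] :: 'a poly"
  have "Polynomial.coeff ?f n = 1" using assms by (cases n) auto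
  then have nz: "?f \<noteq> 0" by (metis coeff_0 zero_neq_one)
  have "{x. x ^ n = c} = {x. poly ?f x = 0}" by (auto simp: poly_monom)
  then have "card {x. x ^ n = c} \<le> Polynomial.degree ?f" using card_poly_roots_bound[OF nz] by simp
  also have "\<dots> \<le> n" by (intro degree_diff_le) (auto simp: degree_monom_le)
  finally show ?thesis .
qed

text \<open>The \<open>p\<close> roots of \<open>X\<^sup>p - X\<close> are already exhausted by the multiples of \<open>1\<close>.\<close>

lemma frob_fixed_imp_of_nat:
  assumes "(x::'a) ^ p = x"
  shows "\<exists>n. x = of_nat n"
proof -
  let ?f = "monom 1 p - [:0, 1:] :: 'a poly"
  have "Polynomial.coeff ?f p = 1" using p_gt_1 by (auto simp: coeff_pCons split: nat.splits)
  then have nz: "?f \<noteq> 0" by (metis coeff_0 zero_neq_one)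
  have "Polynomial.degree ?f \<le> p" using p_gt_1 by (intro degree_diff_le) (auto simp: degree_monom_le)
  then have le: "card {x. poly ?f x = 0} \<le> p" using card_poly_roots_bound[OF nz] by simp
  have inj: "inj_on (of_nat :: nat \<Rightarrow> 'a) {..<p}"
  proof (rule inj_onI)
    fix m n assume "m \<in> {..<p}" "n \<in> {..<p}" "of_nat m = (of_nat n :: 'a)"
    then show "m = n"
      by (auto simp: of_nat_eq_iff_cong_CHAR CHAR_F cong_def)
  qed
  have sub: "of_nat ` {..<p} \<subseteq> {x. poly ?f x = 0}"
  proof safe
    fix n
    have "(of_nat n :: 'a) ^ p = of_nat n"
      using frob_add[of _ _ 1] p_gt_1 by (induction n) (auto simp: power_0_left)
    then show "poly ?f (of_nat n) = 0" by (simp add: poly_monom)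
  qed
  have "of_nat ` {..<p} = {x. poly ?f x = 0}"
    using sub le inj by (intro card_seteq) (auto simp: card_image)
  moreover have "x \<in> {x. poly ?f x = 0}" using assms by (simp add: poly_monom)
  ultimately show ?thesis by auto
qed

lemma frob_funpow: "(\<lambda>z::'a. z ^ p) ^^ j = (\<lambda>z. z ^ (p ^ j))"
  by (induction j) (auto simp: fun_eq_iff power_mult[symmetric] mult.commute)

lemma t_map_eq: "t_map p (a::'a) j = (\<lambda>z. a * z ^ (p ^ j))"
  by (simp add: t_map_def tau_def frob_funpow)

lemma frob_mod: "(z::'a) ^ (p ^ j) = z ^ (p ^ (j mod d))"
proof -
  have *: "z ^ (p ^ (d * k)) = z" for k and z :: 'a
    using power_q by (induction k) (simp_all add: power_add power_mult q_eq[symmetric])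
  have "z ^ (p ^ j) = z ^ (p ^ (d * (j div d) + j mod d))" by simp
  also have "\<dots> = (z ^ (p ^ (d * (j div d)))) ^ (p ^ (j mod d))"
    by (simp only: power_add power_mult)
  finally show ?thesis using * by simp
qed

text \<open>
  Distinct exponents below \<open>d\<close> give distinct powers of the Frobenius map, for otherwise
  a nonzero polynomial of degree less than \<open>q\<close> would vanish on the whole field.
\<close>

lemma frob_exponent_unique:
  assumes "i < d" "j < d" and eq: "\<And>z::'a. z ^ (p ^ i) = z ^ (p ^ j)"
  shows "i = j"
proof -
  have "p ^ i < q" "p ^ j < q" using assms p_gt_1 by (simp_all add: q_eq)
  then have "monom 1 (p ^ i) = (monom 1 (p ^ j) :: 'a poly)"
    using eq by (intro poly_eqI_degree[of UNIV]) (auto simp: poly_monom degree_monom_eq card_F)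
  then have "Polynomial.degree (monom (1::'a) (p ^ i)) = Polynomial.degree (monom (1::'a) (p ^ j))" by simp
  then show ?thesis using p_gt_1 by (simp add: degree_monom_eq)
qed

text \<open>
  An automorphism \<open>\<phi>\<close> is determined by the image of a primitive element \<open>g\<close>.  The polynomial
  with the roots \<open>g\<^bsup>p^i\<^esup>\<close>, \<open>i < d\<close>, has coefficients fixed by the Frobenius map, hence by \<open>\<phi>\<close>;
  so \<open>\<phi> g\<close> is again one of these roots.
\<close>

lemma automorphism_is_frob_power:
  assumes "\<phi> \<in> ring_iso (Fq :: 'a ring) Fq"
  shows "\<exists>j<d. \<phi> = (\<lambda>z. z ^ (p ^ j))"
proof -
  have add: "\<phi> (x + y) = \<phi> x + \<phi> y" and mult: "\<phi> (x * y) = \<phi> x * \<phi> y" and one: "\<phi> 1 = 1" for x y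
    using assms by (auto simp: ring_iso_def ring_hom_def)
  have zero: "\<phi> 0 = 0" using add[of 0 0] by (metis add.right_neutral add_left_cancel)
  have pow: "\<phi> (x ^ n) = \<phi> x ^ n" for x n by (induction n) (auto simp: one mult)
  have nat: "\<phi> (of_nat n) = of_nat n" for n by (induction n) (auto simp: zero one add)
  have sum: "\<phi> (sum h A) = (\<Sum>i\<in>A. \<phi> (h i))" for h and A :: "nat set"
    by (induction A rule: infinite_finite_induct) (auto simp: zero add)
  obtain g :: 'a where g: "\<And>x. x \<noteq> 0 \<Longrightarrow> \<exists>i. x = g ^ i" using primitive_element by blast
  define f :: "'a poly" where "f = (\<Prod>i<d. [:- (g ^ (p ^ i)), 1:])"
  have poly_f: "poly f x = (\<Prod>i<d. x - g ^ (p ^ i))" for x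
    by (simp add: f_def poly_prod)
  have deg: "Polynomial.degree f \<le> d"
    using degree_prod_sum_le[of "{..<d}" "\<lambda>i. [:- (g ^ (p ^ i)), 1:]"] by (simp add: f_def o_def)
  have d_less: "d < q" using p_gt_1 by (simp add: q_eq less_exp power_gt_expt)
  define f' where "f' = map_poly (\<lambda>c. c ^ p) f"
  have p0: "(0::'a) ^ p = 0" using p_gt_1 by simp
  have deg': "Polynomial.degree f' \<le> d"
    using deg by (intro degree_le) (auto simp: f'_def coeff_map_poly p0 coeff_eq_0)
  \<comment> \<open>The Frobenius map permutes the roots cyclically, as \<open>g\<^bsup>p^d\<^esup> = g\<close>.\<close>
  have shift: "(\<Prod>i<d. x - g ^ (p ^ Suc i)) = (\<Prod>i<d. x - g ^ (p ^ i))" for x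
  proof -
    obtain d' where d': "d = Suc d'" using d_pos by (cases d) auto
    have "g ^ (p ^ d) = g" using power_q[of g] q_eq by simp
    then show ?thesis
      unfolding d' prod.lessThan_Suc_shift[of "\<lambda>i. x - g ^ (p ^ i)"] prod.lessThan_Suc[of "\<lambda>i. x - g ^ (p ^ Suc i)"]
      by (simp add: mult.commute)
  qed
  have poly_sum: "poly h x = (\<Sum>i\<le>d. Polynomial.coeff h i * x ^ i)" if "Polynomial.degree h \<le> d" for h :: "'a poly" and x
    unfolding poly_altdef using that by (intro sum.mono_neutral_left) (auto simp: coeff_eq_0)
  \<comment> \<open>Both polynomials have degree less than \<open>q\<close>, so it suffices to compare their values, and every
     field element is a \<open>p\<close>-th power.\<close>
  have "poly f' x = poly f x" for x
  proof -
    obtain y where y: "x = y ^ p" using surj_frob[of 1] by (auto simp: surj_def)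
    have "poly f' x = (\<Sum>i\<le>d. Polynomial.coeff f' i * x ^ i)"
      using poly_sum[OF deg'] .
    also have "\<dots> = (\<Sum>i\<le>d. (Polynomial.coeff f i * y ^ i) ^ p)"
    proof (rule sum.cong)
      fix i
      have "x ^ i = (y ^ i) ^ p" unfolding y by (simp only: power_mult[symmetric] mult.commute)
      then show "Polynomial.coeff f' i * x ^ i = (Polynomial.coeff f i * y ^ i) ^ p"
        by (simp only: f'_def coeff_map_poly[of "\<lambda>c. c ^ p", OF p0] power_mult_distrib)
    qed simp
    also have "\<dots> = (\<Sum>i\<le>d. Polynomial.coeff f i * y ^ i) ^ p"
      by (rule freshmans_dream_sum[symmetric]) (simp_all only: CHAR_F prime_p)
    also have "\<dots> = poly f y ^ p" using poly_sum[OF deg] by simp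
    also have "\<dots> = (\<Prod>i<d. (y - g ^ (p ^ i)) ^ p)" by (simp add: poly_f prod_power_distrib)
    also have "\<dots> = (\<Prod>i<d. x - g ^ (p ^ Suc i))"
      using frob_diff[of _ _ 1] by (simp add: y power_mult[symmetric] mult.commute)
    finally show ?thesis using shift poly_f by simp
  qed
  then have "f' = f" using deg deg' d_less
    by (intro poly_eqI_degree[of UNIV]) (auto simp: card_F)
  then have "Polynomial.coeff f i ^ p = Polynomial.coeff f i" for i
    using coeff_map_poly[of "\<lambda>c. c ^ p" f i] p0 by (simp add: f'_def)
  then have "\<exists>n. Polynomial.coeff f i = of_nat n" for i by (intro frob_fixed_imp_of_nat)
  then have fix_coeff: "\<phi> (Polynomial.coeff f i) = Polynomial.coeff f i" for i
    using nat by metis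
  have "poly f g = 0" unfolding poly_f using d_pos by (intro prod_zero) (auto intro!: bexI[of _ 0])
  then have "\<phi> (poly f g) = 0" using zero by simp
  moreover have "\<phi> (poly f g) = poly f (\<phi> g)"
    unfolding poly_altdef sum mult pow fix_coeff ..
  ultimately obtain j where j: "j < d" "\<phi> g = g ^ (p ^ j)" by (auto simp: poly_f)
  have "\<phi> z = z ^ (p ^ j)" for z
  proof (cases "z = 0")
    case True
    then show ?thesis using zero p_gt_1 by simp
  next
    case False
    then obtain i where "z = g ^ i" using g by blast
    then show ?thesis by (simp add: pow j power_mult[symmetric] mult.commute)
  qed
  then show ?thesis using j(1) by blast
qed

end

section \<open>Divisibility by powers of two\<close>

text \<open>
  Induction on \<open>k\<close> by \<open>x\<^sup>2 - 1 = (x - 1) (x + 1)\<close>; the sharper bound starts from \<open>8\<close> dividing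
  \<open>p\<^sup>2 - 1\<close>.
\<close>

lemma two_power_dvd_power_minus_1:
  assumes "odd (p::nat)"
  shows "2 ^ Suc k dvd p ^ (2 ^ k) - 1" and "k > 0 \<Longrightarrow> 2 ^ (k + 2) dvd p ^ (2 ^ k) - 1"
proof -
  have step: "p ^ (2 ^ Suc k) - 1 = (p ^ (2 ^ k) - 1) * (p ^ (2 ^ k) + 1)" for k
    using assms by (cases "p = 0") (simp_all add: power_mult power2_eq_square algebra_simps power_Suc2 diff_mult_distrib)
  have ev: "even (p ^ (2 ^ k) + 1)" for k using assms by simp
  show "2 ^ Suc k dvd p ^ (2 ^ k) - 1"
  proof (induction k)
    case (Suc k)
    then show ?case unfolding step[of k] using mult_dvd_mono[OF Suc ev[of k]] by (simp add: mult.commute)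
  qed (use assms in simp)
  have "8 dvd p ^ 2 - 1"
  proof -
    obtain m where "p = 2 * m + 1" using assms by (elim oddE)
    then have *: "p ^ 2 - 1 = 4 * (m * (m + 1))" by (simp add: power2_eq_square algebra_simps)
    have "even (m * (m + 1))" by simp
    then have "4 * 2 dvd 4 * (m * (m + 1))" by (rule mult_dvd_mono[OF dvd_refl])
    then show ?thesis unfolding * by simp
  qed
  then have base: "2 ^ (Suc 0 + 2) dvd p ^ (2 ^ Suc 0) - 1" by simp
  show "2 ^ (k + 2) dvd p ^ (2 ^ k) - 1" if "k > 0"
    using that
  proof (induction k rule: nat_induct_non_zero)
    case (Suc k)
    show ?case unfolding step[of k] using mult_dvd_mono[OF Suc(2) ev[of k]] by (simp add: mult.commute)
  qed (use base in simp)
qed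

lemma power_minus_1_dvd: "(p::nat) ^ a - 1 dvd p ^ (a * b) - 1"
proof (cases "p = 0")
  case False
  have "[p ^ a = 1] (mod (p ^ a - 1))" using False by (simp add: cong_altdef_nat)
  then have "[(p ^ a) ^ b = 1 ^ b] (mod (p ^ a - 1))" by (rule cong_pow)
  then show ?thesis using False by (simp add: power_mult cong_altdef_nat)
qed (cases "a = 0"; cases "b = 0"; simp add: power_0_left)

lemma two_part_of_power_minus_1:
  assumes "odd (p::nat)" "2 ^ k dvd d"
  shows "2 ^ Suc k dvd p ^ d - 1" and "k > 0 \<Longrightarrow> 2 ^ (k + 2) dvd p ^ d - 1"
  using two_power_dvd_power_minus_1[OF assms(1), of k] power_minus_1_dvd[of p "2 ^ k"] assms(2)
  by (auto elim!: dvdE[of "2 ^ k" d] intro: dvd_trans)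

section \<open>Finite groups of permutations\<close>

definition perm_group :: "('a \<Rightarrow> 'a) set \<Rightarrow> bool" where
  "perm_group S \<longleftrightarrow> id \<in> S \<and> (\<forall>f\<in>S. \<forall>g\<in>S. f \<circ> g \<in> S) \<and> (\<forall>f\<in>S. bij f)"

lemma perm_groupD:
  assumes "perm_group S"
  shows "id \<in> S" "f \<in> S \<Longrightarrow> g \<in> S \<Longrightarrow> f \<circ> g \<in> S" "f \<in> S \<Longrightarrow> bij f"
  using assms by (auto simp: perm_group_def)

lemma perm_group_inv:
  fixes S :: "('a::finite \<Rightarrow> 'a) set"
  assumes S: "perm_group S" and f: "f \<in> S"
  shows "inv_into UNIV f \<in> S"
proof -
  \<comment> \<open>Left multiplication by \<open>f\<close> is injective on the finite set \<open>S\<close>, so some \<open>f \<circ> g\<close> is the identity.\<close>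
  have "inj_on ((\<circ>) f) S"
    using perm_groupD(3)[OF S f] by (auto simp: inj_on_def fun_eq_iff bij_def dest: injD)
  moreover have "(\<circ>) f ` S \<subseteq> S" using perm_groupD(2)[OF S f] by auto
  ultimately have "(\<circ>) f ` S = S" by (intro card_subset_eq) (auto simp: card_image)
  then obtain g where g: "g \<in> S" "f \<circ> g = id" using perm_groupD(1)[OF S] by (metis imageE)
  then have "f (g z) = z" for z by (metis comp_apply id_apply)
  then have "inv_into UNIV f = g" using perm_groupD(3)[OF S f] by (metis bij_inv_eq_iff ext)
  then show ?thesis using g by simp
qed

text \<open>
  The orbit-stabilizer theorem, the order of a semilinear
  group and the number of components of equal size in a graph are all counted by this.
\<close>

lemma card_eq_card_image_times_fibre:
  assumes "finite S" "\<And>g. g \<in> S \<Longrightarrow> card {h\<in>S. F h = F g} = k"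
  shows "card S = card (F ` S) * k"
proof -
  have "card S = (\<Sum>y\<in>F ` S. card {h\<in>S. F h = y})"
    using sum.image_gen[OF assms(1), of "\<lambda>_. 1::nat" F] by simp
  also have "\<dots> = (\<Sum>y\<in>F ` S. k)" using assms(2) by (intro sum.cong) auto
  finally show ?thesis by simp
qed

lemma orbit_stabilizer:
  fixes S :: "('a::finite \<Rightarrow> 'a) set" and act :: "('a \<Rightarrow> 'a) \<Rightarrow> 'b \<Rightarrow> 'b"
  assumes S: "perm_group S"
    and act_id: "\<And>y. act id y = y"
    and act_comp: "\<And>f g y. act (f \<circ> g) y = act f (act g y)"
  shows "card S = card ((\<lambda>g. act g x) ` S) * card {g\<in>S. act g x = x}"
proof (rule card_eq_card_image_times_fibre)
  fix g assume g: "g \<in> S"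
  have bij: "bij g" and gi: "inv_into UNIV g \<in> S" using perm_groupD(3) perm_group_inv S g by auto
  have inv: "inv_into UNIV g \<circ> g = id" "g \<circ> inv_into UNIV g = id"
    using bij by (auto simp: bij_def surj_iff)
  show "card {h\<in>S. act h x = act g x} = card {g\<in>S. act g x = x}"
  proof (rule bij_betw_same_card[symmetric], rule bij_betw_byWitness[where f = "(\<circ>) g" and f' = "(\<circ>) (inv_into UNIV g)"])
    show "(\<circ>) g ` {h\<in>S. act h x = x} \<subseteq> {h\<in>S. act h x = act g x}"
      using g S by (auto simp: act_comp perm_groupD(2))
    show "(\<circ>) (inv_into UNIV g) ` {h\<in>S. act h x = act g x} \<subseteq> {h\<in>S. act h x = x}"
    proof safe
      fix h assume h: "h \<in> S" "act h x = act g x"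
      show "inv_into UNIV g \<circ> h \<in> S" using h gi S perm_groupD(2) by blast
      have "act (inv_into UNIV g \<circ> h) x = act (inv_into UNIV g \<circ> g) x" using h by (simp only: act_comp)
      then show "act (inv_into UNIV g \<circ> h) x = x" by (simp only: inv act_id)
    qed
  qed (auto simp: comp_assoc[symmetric] inv)
qed simp

lemma perm_group_stabilizer:
  assumes "perm_group S" "\<And>y. act id y = y" "\<And>f g y. act (f \<circ> g) y = act f (act g y)"
  shows "perm_group {g\<in>S. act g x = x}"
  using assms by (auto simp: perm_group_def)

section \<open>Multiplicatively closed sets of field elements\<close>

lemma power_card_eq_1:
  fixes A :: "'a::field set"
  assumes "finite A" "0 \<notin> A" "\<And>x y. x \<in> A \<Longrightarrow> y \<in> A \<Longrightarrow> x * y \<in> A" "x \<in> A"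
  shows "x ^ card A = 1"
proof -
  have inj: "inj_on ((*) x) A" using assms by (auto simp: inj_on_def)
  have "(*) x ` A = A" using assms inj by (intro card_subset_eq) (auto simp: card_image)
  then have "\<Prod>A = \<Prod>((*) x ` A)" by simp
  also have "\<dots> = (\<Prod>y\<in>A. x * y)" by (simp add: prod.reindex[OF inj])
  also have "\<dots> = x ^ card A * \<Prod>A" by (simp add: prod.distrib)
  finally show ?thesis using assms(1,2) by auto
qed

lemma group_Fq_mult: "group (Fq_mult :: 'a::field monoid)"
proof -
  interpret field "Fq :: 'a ring" by (rule field_from_type_algebra)
  show ?thesis
    using field_mult_group by (simp add: Ring_Divisibility.mult_of_def Multiplicative_Group.mult_of_def)
qed

lemma subgroup_Fq_multI:
  fixes A :: "'a::{field,finite} set"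
  assumes "0 \<notin> A" "1 \<in> A" "\<And>x y. x \<in> A \<Longrightarrow> y \<in> A \<Longrightarrow> x * y \<in> A"
  shows "subgroup A (Fq_mult :: 'a monoid)"
proof -
  interpret G: group "Fq_mult :: 'a monoid" by (rule group_Fq_mult)
  show ?thesis
  proof (rule G.subgroupI)
    fix x assume x: "x \<in> A"
    have "card A > 0" using assms(2) by (auto simp: card_gt_0_iff)
    then have "x * x ^ (card A - 1) = 1"
      using power_card_eq_1[OF _ assms(1,3) x] by (simp flip: power_Suc)
    moreover have "x ^ k \<in> A" for k using assms x by (induction k) auto
    moreover have "x \<noteq> 0" "x ^ (card A - 1) \<noteq> 0" using assms(1) x by auto
    ultimately have "inv\<^bsub>Fq_mult\<^esub> x = x ^ (card A - 1)"
      using G.inv_equality[of "x ^ (card A - 1)" x] by (simp add: mult.commute)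
    then show "inv\<^bsub>Fq_mult\<^esub> x \<in> A" using \<open>\<And>k. x ^ k \<in> A\<close> by simp
  qed (use assms in auto)
qed

text \<open>
  If all elements of \<open>A\<close> satisfied \<open>x\<^sup>n = 1\<close> for \<open>n\<close> half the order of \<open>A\<close>, there would be too
  many roots; any other \<open>x\<^sup>n\<close> is a square root of \<open>1\<close> different from \<open>1\<close>.
\<close>

lemma (in galois_field) minus_1_mem_if_even_card:
  fixes A :: "'a set"
  assumes "0 \<notin> A" "1 \<in> A" and closed: "\<And>x y. x \<in> A \<Longrightarrow> y \<in> A \<Longrightarrow> x * y \<in> A"
    and "even (card A)"
  shows "- 1 \<in> A"
proof -
  define n where "n = card A div 2"
  have card: "card A = n * 2" using assms(4) by (simp add: n_def)
  have "card A > 0" using assms(2) by (auto simp: card_gt_0_iff)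
  then have n: "n > 0" using card by simp
  have "\<exists>x\<in>A. x ^ n \<noteq> 1"
  proof (rule ccontr)
    assume "\<not> ?thesis"
    then have "A \<subseteq> {x. x ^ n = 1}" by auto
    then have "card A \<le> card {x::'a. x ^ n = 1}" by (intro card_mono) auto
    also have "\<dots> \<le> n"
      using n by (intro card_power_eq_le)
    finally show False using n card by simp
  qed
  then obtain x where x: "x \<in> A" "x ^ n \<noteq> 1" by blast
  have "(x ^ n) ^ 2 = 1"
    using power_card_eq_1[OF _ assms(1) closed x(1)] by (simp add: card power_mult)
  then have "x ^ n = - 1" using x(2) by (simp add: power2_eq_1_iff)
  moreover have "x ^ k \<in> A" for k using assms(2) closed x(1) by (induction k) auto
  ultimately show ?thesis by metis
qed

section \<open>Groups of semilinear maps\<close>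

text \<open>
  For \<open>S = G\<^sub>0\<close> and \<open>S = G\<^bsub>0,P\<^esub>\<close>, the set \<open>scalars p S\<close> is \<open>H\<close> and \<open>K\<close>, and \<open>least_exp p S\<close> is
  \<open>s\<close> and \<open>e s\<close>; treating both groups at once makes their orders comparable.
\<close>

definition scalars :: "nat \<Rightarrow> ('a::field \<Rightarrow> 'a) set \<Rightarrow> 'a set" where
  "scalars p S = {a. a \<noteq> 0 \<and> t_map p a 0 \<in> S}"

definition frob_exps :: "nat \<Rightarrow> ('a::field \<Rightarrow> 'a) set \<Rightarrow> nat set" where
  "frob_exps p S = {j. \<exists>a. a \<noteq> 0 \<and> t_map p a j \<in> S}"

definition least_exp :: "nat \<Rightarrow> ('a::field \<Rightarrow> 'a) set \<Rightarrow> nat" where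
  "least_exp p S = (LEAST s. 0 < s \<and> s \<in> frob_exps p S)"

locale semilinear_group = galois_field F p d q
  for F :: "'a::{field,finite} itself" and p d q +
  fixes S :: "('a \<Rightarrow> 'a) set"
  assumes perm_group: "perm_group S"
    and semilinear: "f \<in> S \<Longrightarrow> \<exists>a j. a \<noteq> 0 \<and> f = t_map p a j"
begin

lemma zero_in_frob_exps: "0 \<in> frob_exps p S"
  using perm_groupD(1)[OF perm_group] by (auto simp: frob_exps_def t_map_eq id_def intro!: exI[of _ 1])

lemma d_in_frob_exps: "d \<in> frob_exps p S"
proof -
  have "t_map p 1 d = (id :: 'a \<Rightarrow> 'a)" using power_q by (simp add: t_map_eq q_eq[symmetric] id_def)
  then show ?thesis
    using perm_groupD(1)[OF perm_group] unfolding frob_exps_def by (auto intro!: exI[of _ 1])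
qed

lemma frob_exps_add:
  assumes "i \<in> frob_exps p S" "j \<in> frob_exps p S"
  shows "i + j \<in> frob_exps p S"
proof -
  obtain a b where ab: "a \<noteq> 0" "b \<noteq> 0" "t_map p a i \<in> S" "t_map p b j \<in> S"
    using assms by (auto simp: frob_exps_def)
  have "t_map p a i \<circ> t_map p b j = t_map p (a * b ^ (p ^ i)) (i + j)"
    by (simp add: t_map_eq fun_eq_iff power_mult_distrib power_mult[symmetric] power_add mult_ac)
  then have "t_map p (a * b ^ (p ^ i)) (i + j) \<in> S"
    using perm_groupD(2)[OF perm_group ab(3,4)] by simp
  then show ?thesis using ab unfolding frob_exps_def by (auto intro!: exI[of _ "a * b ^ (p ^ i)"])
qed

lemma frob_exps_diff:
  assumes "i \<in> frob_exps p S" "j \<in> frob_exps p S" "i \<le> j"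
  shows "j - i \<in> frob_exps p S"
proof -
  obtain a b where ab: "a \<noteq> 0" "b \<noteq> 0" "t_map p a i \<in> S" "t_map p b j \<in> S"
    using assms by (auto simp: frob_exps_def)
  \<comment> \<open>The quotient of \<open>t_map p b j\<close> by \<open>t_map p a i\<close> has scalar the \<open>p\<^sup>i\<close>-th root of \<open>b / a\<close>.\<close>
  obtain c where c: "b / a = c ^ (p ^ i)" using surj_frob[of i] by (auto simp: surj_def)
  have "t_map p a i (t_map p c (j - i) z) = t_map p b j z" for z
  proof -
    have "b * z ^ (p ^ j) = a * ((b / a) * z ^ (p ^ (j - i + i)))" using assms(3) ab by simp
    then show ?thesis
      unfolding t_map_eq c power_mult_distrib power_add power_mult by simp
  qed
  then have "t_map p c (j - i) = inv_into UNIV (t_map p a i) \<circ> t_map p b j"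
    using perm_groupD(3)[OF perm_group ab(3)] by (auto simp: fun_eq_iff bij_def inv_f_f)
      (metis inv_f_f)
  moreover have "inv_into UNIV (t_map p a i) \<circ> t_map p b j \<in> S"
    using perm_groupD(2) perm_group_inv perm_group ab by blast
  moreover have "c \<noteq> 0"
    using c ab p_gt_1 by (auto simp: power_0_left)
  ultimately show ?thesis unfolding frob_exps_def by (auto intro!: exI[of _ c])
qed

lemma least_exp_pos: "0 < least_exp p S" and least_exp_mem: "least_exp p S \<in> frob_exps p S"
  and least_exp_le: "0 < j \<Longrightarrow> j \<in> frob_exps p S \<Longrightarrow> least_exp p S \<le> j"
proof -
  have "0 < d \<and> d \<in> frob_exps p S" using d_pos d_in_frob_exps by simp
  then show "0 < least_exp p S" "least_exp p S \<in> frob_exps p S"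
    unfolding least_exp_def by (metis (mono_tags, lifting) LeastI)+
  show "0 < j \<Longrightarrow> j \<in> frob_exps p S \<Longrightarrow> least_exp p S \<le> j"
    unfolding least_exp_def by (rule Least_le) simp
qed

text \<open>
  Being closed under sums and under differences, the set of exponents is the trace on the natural
  numbers of a subgroup of the integers.
\<close>

lemma frob_exps_iff: "j \<in> frob_exps p S \<longleftrightarrow> least_exp p S dvd j"
proof
  have "j mod least_exp p S \<in> frob_exps p S" if "j \<in> frob_exps p S" for j
    using that
  proof (induction j rule: less_induct)
    case (less j)
    show ?case
    proof (cases "j < least_exp p S")
      case False
      then have "j - least_exp p S \<in> frob_exps p S"
        using frob_exps_diff[OF least_exp_mem less(2)] by simp
      then have "(j - least_exp p S) mod least_exp p S \<in> frob_exps p S"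
        using less(1)[of "j - least_exp p S"] False least_exp_pos by simp
      then show ?thesis using False by (simp add: le_mod_geq)
    qed (use less in simp)
  qed
  then show "j \<in> frob_exps p S \<Longrightarrow> least_exp p S dvd j"
    using least_exp_le[of "j mod least_exp p S"] mod_less_divisor[OF least_exp_pos, of j]
    by (metis gr0I leD mod_0_imp_dvd)
next
  have "least_exp p S * k \<in> frob_exps p S" for k
    using zero_in_frob_exps frob_exps_add[OF least_exp_mem] by (induction k) auto
  then show "least_exp p S dvd j \<Longrightarrow> j \<in> frob_exps p S" by (auto elim: dvdE)
qed

lemma least_exp_dvd_d: "least_exp p S dvd d"
  using d_in_frob_exps frob_exps_iff by simp

text \<open>
  The automorphism part \<open>z \<mapsto> z\<^bsup>p^j\<^esup>\<close> of \<open>t_map p a j\<close> is recovered as \<open>z \<mapsto> f z / f 1\<close>; the fibres of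
  this map are the cosets of the group of scalars.
\<close>

lemma card_eq: "card S = card (scalars p S) * (d div least_exp p S)"
proof -
  define F where "F f = (\<lambda>z::'a. f z / f 1)" for f :: "'a \<Rightarrow> 'a"
  have F_t: "F (t_map p a j) = (\<lambda>z. z ^ (p ^ j))" if "a \<noteq> 0" for a j
    using that by (simp add: F_def t_map_eq)
  have "card S = card (F ` S) * card (scalars p S)"
  proof (rule card_eq_card_image_times_fibre)
    fix g assume g: "g \<in> S"
    then obtain a j where aj: "a \<noteq> 0" "g = t_map p a j" using semilinear by blast
    have inv: "g \<circ> inv_into UNIV g = id" "inv_into UNIV g \<in> S"
      using perm_groupD(3) perm_group_inv perm_group g by (auto simp: bij_def surj_iff)
    have shift: "t_map p b 0 \<circ> g = t_map p (b * a) j" for b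
      by (simp add: aj t_map_eq fun_eq_iff)
    have "{h \<in> S. F h = F g} = (\<lambda>b. t_map p (b * a) j) ` scalars p S"
    proof (intro Set.set_eqI iffI)
      fix h assume "h \<in> {h \<in> S. F h = F g}"
      then have h: "h \<in> S" "F h = F g" by auto
      then obtain c i where ci: "c \<noteq> 0" "h = t_map p c i" using semilinear by blast
      have "h = t_map p ((c / a) * a) j"
      proof -
        have "(\<lambda>z. z ^ (p ^ i)) = (\<lambda>z::'a. z ^ (p ^ j))" using h(2) ci aj F_t by simp
        then have "z ^ (p ^ i) = z ^ (p ^ j)" for z :: 'a by (rule fun_cong)
        then show ?thesis using ci aj by (simp add: t_map_eq)
      qed
      moreover from this have "t_map p (c / a) 0 = h \<circ> inv_into UNIV g"
        by (metis shift comp_assoc comp_id inv(1))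
      then have "c / a \<in> scalars p S"
        using perm_groupD(2)[OF perm_group h(1) inv(2)] ci aj by (simp add: scalars_def)
      ultimately show "h \<in> (\<lambda>b. t_map p (b * a) j) ` scalars p S" by blast
    next
      fix h assume "h \<in> (\<lambda>b. t_map p (b * a) j) ` scalars p S"
      then obtain b where b: "b \<noteq> 0" "t_map p b 0 \<in> S" "h = t_map p (b * a) j"
        by (auto simp: scalars_def)
      then show "h \<in> {h \<in> S. F h = F g}"
        using shift[of b] perm_groupD(2)[OF perm_group b(2) g] aj F_t[of a j] F_t[of "b * a" j] by simp
    qed
    moreover have "inj_on (\<lambda>b. t_map p (b * a) j) (scalars p S)"
    proof (rule inj_onI)
      fix b c assume "t_map p (b * a) j = t_map p (c * a) j"
      then have "t_map p (b * a) j 1 = t_map p (c * a) j 1" by simp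
      then show "b = c" using aj by (simp add: t_map_eq)
    qed
    ultimately show "card {h \<in> S. F h = F g} = card (scalars p S)" by (simp add: card_image)
  qed simp
  moreover have "card (F ` S) = d div least_exp p S"
  proof -
    let ?s = "least_exp p S"
    have "F ` S = (\<lambda>j z. z ^ (p ^ j)) ` {j. j < d \<and> ?s dvd j}"
    proof (intro Set.set_eqI iffI)
      fix f assume "f \<in> F ` S"
      then obtain h where h: "h \<in> S" "f = F h" by blast
      then obtain a j where aj: "a \<noteq> 0" "h = t_map p a j" using semilinear by blast
      have "?s dvd j" using aj h frob_exps_iff[of j] by (auto simp: frob_exps_def)
      then have "?s dvd j mod d" using least_exp_dvd_d by (simp add: dvd_mod)
      moreover have "f = (\<lambda>z. z ^ (p ^ (j mod d)))" using frob_mod[of _ j] F_t aj h by simp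
      ultimately show "f \<in> (\<lambda>j z. z ^ (p ^ j)) ` {j. j < d \<and> ?s dvd j}"
        using d_pos by auto
    next
      fix f :: "'a \<Rightarrow> 'a" assume "f \<in> (\<lambda>j z. z ^ (p ^ j)) ` {j. j < d \<and> ?s dvd j}"
      then obtain j where j: "?s dvd j" "f = (\<lambda>z. z ^ (p ^ j))" by blast
      then obtain a where "a \<noteq> 0" "t_map p a j \<in> S"
        using frob_exps_iff[of j] by (auto simp: frob_exps_def)
      then show "f \<in> F ` S" using j F_t[of a j] by (auto intro!: image_eqI[of _ _ "t_map p a j"])
    qed
    moreover have "inj_on (\<lambda>j z. (z::'a) ^ (p ^ j)) {j. j < d \<and> ?s dvd j}"
      by (rule inj_onI) (auto intro: frob_exponent_unique dest: fun_cong)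
    moreover have "{j. j < d \<and> ?s dvd j} = (*) ?s ` {..<d div ?s}"
      using least_exp_dvd_d least_exp_pos by (auto simp: image_iff elim!: dvdE)
    moreover have "inj_on ((*) ?s) {..<d div ?s}" using least_exp_pos by (auto simp: inj_on_def)
    ultimately show ?thesis by (simp add: card_image)
  qed
  ultimately show ?thesis by (simp add: mult.commute)
qed

text \<open>The order of the group is the number of scalars times a divisor of \<open>d\<close>.\<close>

lemma two_power_dvd_d:
  assumes "odd (card (scalars p S))" "2 ^ k dvd card S"
  shows "2 ^ k dvd d"
proof -
  have "coprime (2 ^ k) (card (scalars p S))" using assms(1) by simp
  then have "2 ^ k dvd d div least_exp p S"
    using assms(2) unfolding card_eq by (simp add: coprime_dvd_mult_right_iff)
  also have "\<dots> dvd d" using least_exp_dvd_d by (metis dvd_mult_div_cancel dvd_triv_right)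
  finally show ?thesis .
qed

lemma scalars_closed:
  "0 \<notin> scalars p S" "1 \<in> scalars p S" "a \<in> scalars p S \<Longrightarrow> b \<in> scalars p S \<Longrightarrow> a * b \<in> scalars p S"
proof -
  show "0 \<notin> scalars p S" by (simp add: scalars_def)
  show "1 \<in> scalars p S"
    proof -
    have "t_map p 1 0 = (id :: 'a \<Rightarrow> 'a)" by (rule ext) (simp add: t_map_eq)
    then show ?thesis using perm_groupD(1)[OF perm_group] by (simp add: scalars_def)
  qed
  assume ab: "a \<in> scalars p S" "b \<in> scalars p S"
  then have "t_map p a 0 \<circ> t_map p b 0 \<in> S" using perm_groupD(2)[OF perm_group] by (simp add: scalars_def)
  moreover have "t_map p a 0 \<circ> t_map p b 0 = t_map p (a * b) 0"
    by (simp add: t_map_eq fun_eq_iff)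
  ultimately show "a * b \<in> scalars p S" using ab by (simp add: scalars_def)
qed

lemma subgroup_scalars: "subgroup (scalars p S) (Fq_mult :: 'a monoid)"
  using scalars_closed by (intro subgroup_Fq_multI) auto

end

section \<open>Two-transitive groups of affine semilinear maps\<close>

locale affine_block = galois_field F p d q
  for F :: "'a::{field,finite} itself" and p d q +
  fixes G :: "('a \<Rightarrow> 'a) set" and P :: "'a set"
  assumes subgroup_G: "subgroup G AGammaL1"
    and two_trans: "two_transitive G"
    and block: "imprimitive_block (stab0 G) P"
    and one_in_P: "1 \<in> P"
begin

lemma affine: "f \<in> G \<Longrightarrow> \<exists>a c j. a \<noteq> 0 \<and> f = (\<lambda>z. a * z ^ (p ^ j) + c)"
proof -
  assume "f \<in> G"
  then have "f \<in> carrier AGammaL1" using subgroup.subset[OF subgroup_G] by blast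
  then obtain a c \<phi> where f: "f = tau a c \<phi>" "a \<noteq> 0" "\<phi> \<in> ring_iso Fq Fq"
    by (auto simp: AGammaL1_def)
  then obtain j where "\<phi> = (\<lambda>z. z ^ (p ^ j))" using automorphism_is_frob_power by blast
  then have "f = (\<lambda>z. a * z ^ (p ^ j) + c)" using f by (simp add: tau_def)
  then show ?thesis using f(2) by blast
qed

lemma perm_group_G: "perm_group G"
  unfolding perm_group_def
proof (intro conjI ballI)
  show "id \<in> G" using subgroup.one_closed[OF subgroup_G] by (simp add: AGammaL1_def)
  show "f \<circ> g \<in> G" if "f \<in> G" "g \<in> G" for f g
    using subgroup.m_closed[OF subgroup_G that(2,1)] by (simp add: AGammaL1_def)
  show "bij f" if "f \<in> G" for f
  proof -
    from affine[OF that] obtain a c j where f: "a \<noteq> 0" "f = (\<lambda>z. a * z ^ (p ^ j) + c)" by blast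
    have "inj f" using f inj_frob[of j] by (auto simp: inj_on_def)
    then show ?thesis by (simp add: bij_def finite_UNIV_inj_surj)
  qed
qed

lemmas G_comp = perm_groupD(2)[OF perm_group_G]
  and G_bij = perm_groupD(3)[OF perm_group_G]
  and G_inv = perm_group_inv[OF perm_group_G]

lemma stab0_semilinear: "f \<in> stab0 G \<Longrightarrow> \<exists>a j. a \<noteq> 0 \<and> f = t_map p a j"
proof -
  assume f: "f \<in> stab0 G"
  then obtain a c j where "a \<noteq> 0" "f = (\<lambda>z. a * z ^ (p ^ j) + c)"
    using affine[of f] by (auto simp: stab0_def)
  moreover from this have "c = 0" using f p_gt_1 by (simp add: stab0_def power_0_left)
  ultimately show ?thesis by (auto simp: t_map_eq)
qed

sublocale G0: semilinear_group F p d q "stab0 G"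
proof
  show "perm_group (stab0 G)"
    using perm_group_stabilizer[OF perm_group_G, of "\<lambda>f. f" 0] by (simp add: stab0_def)
qed (rule stab0_semilinear)

sublocale G0P: semilinear_group F p d q "stab0_set G P"
proof
  show "perm_group (stab0_set G P)"
    using perm_group_stabilizer[OF G0.perm_group, of "image" P]
    by (simp add: stab0_set_def image_comp)
qed (use stab0_semilinear in \<open>simp add: stab0_set_def\<close>)

lemma stab0_0: "g \<in> stab0 G \<Longrightarrow> g 0 = 0"
  by (simp add: stab0_def)

lemma stab0_add: "g \<in> stab0 G \<Longrightarrow> g (x + y) = g x + g y"
  using stab0_semilinear[of g] by (auto simp: t_map_eq frob_add distrib_left)

lemma stab0_minus: "g \<in> stab0 G \<Longrightarrow> g (- x) = - g x"
  using stab0_semilinear[of g] by (auto simp: t_map_eq frob_minus)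

lemma stab0_bij: "g \<in> stab0 G \<Longrightarrow> bij g"
  using perm_groupD(3)[OF G0.perm_group] .

lemma stab0_transitive:
  assumes "x \<noteq> 0" "y \<noteq> 0"
  obtains g where "g \<in> stab0 G" "g x = y"
proof -
  have "0 \<noteq> x" "0 \<noteq> y" using assms by auto
  then obtain g where "g \<in> G" "g 0 = 0" "g x = y"
    using two_trans unfolding two_transitive_def by blast
  then show thesis using that by (auto simp: stab0_def)
qed

lemma card_nonzero: "card (UNIV - {0::'a}) = q - 1"
  by (simp add: card_Diff_subset card_F)

text \<open>
  Otherwise a map in \<open>G\<close> would be determined by its linear part; but there are at most \<open>(q - 1) d\<close>
  linear parts, and \<open>d < q\<close>, while \<open>G\<close> has at least \<open>q (q - 1)\<close> elements.
\<close>

lemma nontrivial_translation_mem: "\<exists>c. c \<noteq> 0 \<and> (\<lambda>z. z + c) \<in> G"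
proof (rule ccontr)
  assume none: "\<not> ?thesis"
  define lin where "lin f = (\<lambda>z. f z - f 0)" for f :: "'a \<Rightarrow> 'a"
  have "inj_on lin G"
  proof (rule inj_onI)
    fix f g assume fg: "f \<in> G" "g \<in> G" "lin f = lin g"
    have eq: "f z = g z + (f 0 - g 0)" for z
      using fun_cong[OF fg(3), of z] by (simp add: lin_def algebra_simps)
    have "f (inv_into UNIV g z) = z + (f 0 - g 0)" for z
      unfolding eq[of "inv_into UNIV g z"] by (simp add: surj_f_inv_f bij_is_surj G_bij[OF fg(2)])
    then have "f \<circ> inv_into UNIV g = (\<lambda>z. z + (f 0 - g 0))" by (simp add: fun_eq_iff)
    moreover have "f \<circ> inv_into UNIV g \<in> G" using G_comp G_inv fg by blast
    ultimately have "f 0 - g 0 = 0" using none by metis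
    then have "f z = g z" for z using eq[of z] by simp
    then show "f = g" by (rule ext)
  qed
  then have "card G = card (lin ` G)" by (simp add: card_image)
  also have "\<dots> \<le> card ((\<lambda>(a, j) z. a * z ^ (p ^ j)) ` ((UNIV - {0::'a}) \<times> {..<d}))"
  proof (intro card_mono subsetI)
    fix l assume "l \<in> lin ` G"
    then obtain f where f: "f \<in> G" "l = lin f" by blast
    then obtain a c j where aj: "a \<noteq> 0" "f = (\<lambda>z. a * z ^ (p ^ j) + c)" using affine by blast
    then have "l = (\<lambda>z. a * z ^ (p ^ (j mod d)))"
      using p_gt_1 f frob_mod[of _ j] by (simp add: lin_def power_0_left)
    then show "l \<in> (\<lambda>(a, j) z. a * z ^ (p ^ j)) ` ((UNIV - {0}) \<times> {..<d})"
      using aj d_pos by (auto intro!: image_eqI[of _ _ "(a, j mod d)"])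
  qed simp
  also have "\<dots> \<le> card ((UNIV - {0::'a}) \<times> {..<d})" by (rule card_image_le) simp
  also have "\<dots> = (q - 1) * d" by (simp add: card_cartesian_product card_nonzero)
  also have "\<dots> < (q - 1) * q" using q_gt_1 p_gt_1 by (simp add: q_eq power_gt_expt)
  also have "\<dots> = card (SIGMA u:(UNIV::'a set). UNIV - {u})"
    by (simp add: card_SigmaI card_Diff_subset card_F mult.commute)
  also have "\<dots> \<le> card ((\<lambda>f. (f 0, f 1)) ` G)"
  proof (intro card_mono subsetI)
    fix w assume "w \<in> (SIGMA u:(UNIV::'a set). UNIV - {u})"
    then obtain u v where w: "w = (u, v)" "u \<noteq> v" by auto
    moreover have "(0::'a) \<noteq> 1" by simp
    ultimately obtain f where "f \<in> G" "f 0 = u" "f 1 = v"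
      using two_trans unfolding two_transitive_def by metis
    then show "w \<in> (\<lambda>f. (f 0, f 1)) ` G" using w by (auto intro!: image_eqI[of _ _ f])
  qed simp
  also have "\<dots> \<le> card G" by (rule card_image_le) simp
  finally show False by simp
qed

text \<open>Conjugation by the transitive group \<open>G\<^sub>0\<close> moves one nontrivial translation to any other.\<close>

lemma translation_mem: "(\<lambda>z. z + c) \<in> G"
proof (cases "c = 0")
  case True
  then show ?thesis using perm_groupD(1)[OF perm_group_G] by (simp add: id_def)
next
  case False
  obtain b where b: "b \<noteq> 0" "(\<lambda>z. z + b) \<in> G" using nontrivial_translation_mem by blast
  obtain h where h: "h \<in> stab0 G" "h b = c" using stab0_transitive b(1) False .
  then have hG: "h \<in> G" by (simp add: stab0_def)
  have "h \<circ> (\<lambda>z. z + b) \<circ> inv_into UNIV h \<in> G" using G_comp G_inv hG b by blast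
  moreover have "h \<circ> (\<lambda>z. z + b) \<circ> inv_into UNIV h = (\<lambda>z. z + c)"
    using G_bij[OF hG] h by (auto simp: fun_eq_iff stab0_add bij_is_surj surj_f_inv_f)
  ultimately show ?thesis by simp
qed

lemma dvd_card_stab0: "q - 1 dvd card (stab0 G)"
proof -
  have "(\<lambda>g. g 1) ` stab0 G = UNIV - {0}"
  proof (intro Set.set_eqI iffI)
    fix y assume "y \<in> (\<lambda>g. g 1) ` stab0 G"
    then obtain g where g: "g \<in> stab0 G" "y = g 1" by blast
    then have "g 1 \<noteq> g 0" using stab0_bij[OF g(1)] by (simp add: bij_is_inj inj_eq)
    then show "y \<in> UNIV - {0}" using g stab0_0[OF g(1)] by simp
  next
    fix y :: 'a assume "y \<in> UNIV - {0}"
    then obtain g where "g \<in> stab0 G" "g 1 = y" using stab0_transitive[of 1 y] by auto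
    then show "y \<in> (\<lambda>g. g 1) ` stab0 G" by blast
  qed
  then show ?thesis
    using orbit_stabilizer[OF G0.perm_group, of "\<lambda>f. f" 1] card_nonzero by simp
qed

text \<open>
  If \<open>-1\<close> were not a scalar of \<open>G\<^sub>0\<close>, the scalars would have odd order, so that the \<open>2\<close>-part
  of \<open>q - 1\<close> would divide \<open>d\<close>; for odd \<open>q\<close> it is too large for that.
\<close>

lemma minus_1_scalar: "- 1 \<in> scalars p (stab0 G)"
proof (rule ccontr)
  assume notin: "- 1 \<notin> scalars p (stab0 G)"
  have "odd p"
  proof
    assume "even p"
    then have "p = 2" using prime_p primes_dvd_imp_eq two_is_prime_nat by blast
    then have "of_nat 2 = (0::'a)" using CHAR_F of_nat_CHAR[where 'a = 'a] by simp
    then have minus_1: "- 1 = (1::'a)" by (intro minus_unique) simp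
    show False using notin G0.scalars_closed(2) unfolding minus_1 by blast
  qed
  have odd: "odd (card (scalars p (stab0 G)))"
    using notin minus_1_mem_if_even_card[OF G0.scalars_closed] by blast
  let ?k = "multiplicity 2 d"
  have "2 ^ Suc ?k dvd q - 1"
    using two_part_of_power_minus_1(1)[OF \<open>odd p\<close> multiplicity_dvd] by (simp add: q_eq)
  then have "2 ^ Suc ?k dvd card (stab0 G)" using dvd_card_stab0 dvd_trans by blast
  then have "2 ^ Suc ?k dvd d" by (rule G0.two_power_dvd_d[OF odd])
  then show False using d_pos multiplicity_geI[of d 2 "Suc ?k"] by simp
qed

lemma uminus_mem_stab0: "uminus \<in> stab0 G"
proof -
  have "t_map p (- 1) 0 = (uminus :: 'a \<Rightarrow> 'a)" by (rule ext) (simp add: t_map_eq)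
  then show ?thesis using minus_1_scalar by (simp add: scalars_def)
qed

section \<open>The block system of the point stabilizer\<close>

definition blocks :: "'a set set" where
  "blocks = (\<lambda>g. g ` P) ` stab0 G"

lemma P_mem_blocks: "P \<in> blocks"
  unfolding blocks_def using perm_groupD(1)[OF G0.perm_group] by (intro image_eqI[of _ _ id]) auto

lemma image_mem_blocks: "g \<in> stab0 G \<Longrightarrow> A \<in> blocks \<Longrightarrow> g ` A \<in> blocks"
proof -
  assume g: "g \<in> stab0 G" and "A \<in> blocks"
  then obtain h where h: "h \<in> stab0 G" "A = h ` P" by (auto simp: blocks_def)
  have "g ` A = (g \<circ> h) ` P" by (simp add: h(2) image_comp)
  then show "g ` A \<in> blocks"
    unfolding blocks_def using perm_groupD(2)[OF G0.perm_group g h(1)] by (rule image_eqI)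
qed

lemma uminus_mem_blocks: "A \<in> blocks \<Longrightarrow> uminus ` A \<in> blocks"
  using uminus_mem_stab0 by (rule image_mem_blocks)

lemma block_nonzero: "A \<in> blocks \<Longrightarrow> 0 \<notin> A"
proof
  assume "A \<in> blocks" "0 \<in> A"
  then obtain g x where "g \<in> stab0 G" "x \<in> P" "g x = 0" by (auto simp: blocks_def)
  then have "g x = g 0" using stab0_0 by simp
  then have "x = 0" using stab0_bij[OF \<open>g \<in> stab0 G\<close>] by (simp add: bij_is_inj inj_eq)
  then show False using \<open>x \<in> P\<close> block by (auto simp: imprimitive_block_def)
qed

lemma block_card: "A \<in> blocks \<Longrightarrow> card A = card P"
  using card_image[OF inj_on_subset[OF bij_is_inj[OF stab0_bij] subset_UNIV]]
  by (auto simp: blocks_def)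

lemma blocks_disjoint:
  assumes "A \<in> blocks" "B \<in> blocks" "x \<in> A" "x \<in> B"
  shows "A = B"
proof -
  obtain g h where gh: "g \<in> stab0 G" "h \<in> stab0 G" "A = g ` P" "B = h ` P"
    using assms by (auto simp: blocks_def)
  let ?k = "inv_into UNIV h \<circ> g"
  have k: "?k \<in> stab0 G"
    using perm_groupD(2)[OF G0.perm_group] perm_group_inv[OF G0.perm_group] gh by blast
  have hk: "h ` (?k ` P) = A"
    using stab0_bij[OF gh(2)] by (auto simp: gh(3) image_image bij_is_surj surj_f_inv_f)
  have "inv_into UNIV h x \<in> ?k ` P \<inter> P"
    using assms(3,4) gh stab0_bij[OF gh(2)] by (auto simp: bij_is_inj)
  then have "?k ` P = P" using block k unfolding imprimitive_block_def by blast
  then show ?thesis using hk gh by simp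
qed

lemma blocks_cover:
  assumes "x \<noteq> 0"
  obtains A where "A \<in> blocks" "x \<in> A"
proof -
  obtain g where "g \<in> stab0 G" "g 1 = x" using stab0_transitive[of 1 x] assms by auto
  then show thesis using that[of "g ` P"] one_in_P by (auto simp: blocks_def)
qed

lemma card_blocks_times_card_P: "card blocks * card P = q - 1"
proof -
  have "\<Union> blocks = UNIV - {0}" using block_nonzero by (auto elim: blocks_cover)
  moreover have "card P * card blocks = card (\<Union> blocks)"
    by (rule card_partition) (auto simp: block_card dest: blocks_disjoint)
  ultimately show ?thesis using card_nonzero by (simp add: mult.commute)
qed

lemma card_stab0_eq: "card (stab0 G) = card blocks * card (stab0_set G P)"
  using orbit_stabilizer[OF G0.perm_group, of image P]
  by (simp add: blocks_def stab0_set_def image_comp)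

lemma orbit_of_1: "(\<lambda>g. g 1) ` stab0_set G P = P"
proof (intro Set.set_eqI iffI)
  fix y assume "y \<in> (\<lambda>g. g 1) ` stab0_set G P"
  then show "y \<in> P" using one_in_P by (auto simp: stab0_set_def)
next
  fix y assume y: "y \<in> P"
  then have "y \<noteq> 0" using block by (auto simp: imprimitive_block_def)
  then obtain g where g: "g \<in> stab0 G" "g 1 = y" using stab0_transitive[of 1 y] by auto
  then have "y \<in> g ` P \<inter> P" using one_in_P y by auto
  then have "g ` P = P" using block g unfolding imprimitive_block_def by blast
  then show "y \<in> (\<lambda>g. g 1) ` stab0_set G P" using g by (auto simp: stab0_set_def)
qed

lemma card_P_dvd: "card P dvd card (stab0_set G P)"
  using orbit_stabilizer[OF G0P.perm_group, of "\<lambda>f. f" 1] orbit_of_1 by simp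

lemma s_num_eq: "s_num p G = least_exp p (stab0 G)"
  by (simp add: s_num_def least_exp_def frob_exps_def)

text \<open>
  The least exponent of \<open>G\<^bsub>0,P\<^esub>\<close> is a multiple of that of \<open>G\<^sub>0\<close>, and \<open>e\<close> is the quotient.
\<close>

lemma e_num_times: "e_num p G P * least_exp p (stab0 G) = least_exp p (stab0_set G P)"
proof -
  let ?s = "least_exp p (stab0 G)" and ?s' = "least_exp p (stab0_set G P)"
  have "frob_exps p (stab0_set G P) \<subseteq> frob_exps p (stab0 G)"
    by (auto simp: frob_exps_def stab0_set_def)
  then obtain k where k: "?s' = ?s * k"
    using G0P.least_exp_mem G0.frob_exps_iff by (auto elim!: dvdE)
  have mem: "(\<exists>c. c \<noteq> 0 \<and> t_map p c (e * ?s) \<in> stab0_set G P) \<longleftrightarrow> k dvd e" for e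
    using G0P.frob_exps_iff[of "e * ?s"] G0.least_exp_pos k by (simp add: frob_exps_def mult.commute)
  have "e_num p G P = k"
    unfolding e_num_def s_num_eq mem
    by (rule Least_equality) (use G0P.least_exp_pos k in \<open>auto dest: dvd_imp_le\<close>)
  then show ?thesis using k by simp
qed

lemma card_scalars_eq: "card (scalars p (stab0 G)) = HK_order p G P * card (scalars p (stab0_set G P))"
proof -
  let ?H = "scalars p (stab0 G)" and ?K = "scalars p (stab0_set G P)"
  interpret Fq: group "Fq_mult :: 'a monoid" by (rule group_Fq_mult)
  interpret H: group "(Fq_mult :: 'a monoid)\<lparr>carrier := ?H\<rparr>"
    using G0.subgroup_scalars by (rule Fq.subgroup_imp_group)
  have "?K \<subseteq> ?H" by (auto simp: scalars_def stab0_set_def)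
  then have "subgroup ?K ((Fq_mult :: 'a monoid)\<lparr>carrier := ?H\<rparr>)"
    using G0.subgroup_scalars G0P.subgroup_scalars by (intro Fq.subgroup_incl)
  from H.lagrange[OF this] show ?thesis
    by (simp add: HK_order_def Coset.order_def FactGroup_def H_grp_def K_grp_def scalars_def)
qed

text \<open>
  The blocks are the cosets of \<open>G\<^bsub>0,P\<^esub>\<close> in \<open>G\<^sub>0\<close>.  The two orders are \<open>|K| (d / (e s))\<close> and
  \<open>|H| (d / s)\<close>.
\<close>

lemma card_blocks: "card blocks = HK_order p G P * e_num p G P"
proof -
  let ?K = "scalars p (stab0_set G P)"
  let ?m = "d div least_exp p (stab0_set G P)"
  have "card (stab0_set G P) > 0"
    using perm_groupD(1)[OF G0P.perm_group] by (auto simp: card_gt_0_iff)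
  then have pos: "card ?K * ?m > 0" by (simp only: G0P.card_eq)
  obtain m where m: "d = least_exp p (stab0_set G P) * m" using G0P.least_exp_dvd_d by blast
  then have "d div least_exp p (stab0 G) = e_num p G P * m"
    using G0.least_exp_pos by (simp flip: e_num_times)
  moreover have "?m = m" using m G0P.least_exp_pos by simp
  ultimately have "card blocks * (card ?K * ?m) = HK_order p G P * e_num p G P * (card ?K * ?m)"
    using card_stab0_eq unfolding G0.card_eq G0P.card_eq card_scalars_eq by (simp only: mult_ac)
  then show ?thesis using pos by (simp only: mult_right_cancel[OF pos[THEN less_imp_neq, symmetric]])
qed

end

section \<open>Components of symmetric graphs\<close>

context pseudo_graph
begin

lemma connected_iff_reachable:
  "Digraph_Component.connected G \<longleftrightarrow> verts G \<noteq> {} \<and> (\<forall>u\<in>verts G. \<forall>v\<in>verts G. u \<rightarrow>\<^sup>*\<^bsub>G\<^esub> v)"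
proof -
  have "(arcs_ends G)\<^sup>s = arcs_ends G" using graph_symmetric by (auto simp: symcl_def)
  then show ?thesis by (simp add: connected_conv reachable_def)
qed

lemma reachable_sym: "u \<rightarrow>\<^sup>*\<^bsub>G\<^esub> v \<longleftrightarrow> v \<rightarrow>\<^sup>*\<^bsub>G\<^esub> u"
  using symmetric_reachable' by blast

lemma scc_of_eq_reachable: "scc_of u = {v. u \<rightarrow>\<^sup>*\<^bsub>G\<^esub> v}"
  using reachable_sym by (auto simp: scc_of_def)

lemma card_verts_eq_num_components_times:
  assumes "\<And>v. v \<in> verts G \<Longrightarrow> card {w. v \<rightarrow>\<^sup>*\<^bsub>G\<^esub> w} = k"
  shows "card (verts G) = num_components G * k"
proof -
  have "card (verts G) = card (scc_of ` verts G) * k"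
  proof (rule card_eq_card_image_times_fibre)
    fix u assume u: "u \<in> verts G"
    have "{v \<in> verts G. scc_of v = scc_of u} = {v. u \<rightarrow>\<^sup>*\<^bsub>G\<^esub> v}"
    proof (intro Set.set_eqI iffI)
      fix v assume "v \<in> {v \<in> verts G. scc_of v = scc_of u}"
      then have "v \<in> scc_of u" using in_scc_of_self by blast
      then show "v \<in> {v. u \<rightarrow>\<^sup>*\<^bsub>G\<^esub> v}" by (simp add: scc_of_eq_reachable)
    next
      fix v assume "v \<in> {v. u \<rightarrow>\<^sup>*\<^bsub>G\<^esub> v}"
      then show "v \<in> {v \<in> verts G. scc_of v = scc_of u}"
        using scc_of_eq[of v u] by (auto simp: scc_of_eq_reachable elim: reachable_in_vertsE)
    qed
    then show "card {v \<in> verts G. scc_of v = scc_of u} = k" using assms[OF u] by simp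
  qed (rule finite_verts)
  then show ?thesis by (simp add: num_components_def card_sccs_verts[symmetric] sccs_verts_conv_scc_of)
qed

lemma connected_iff_card:
  assumes "\<And>v. v \<in> verts G \<Longrightarrow> card {w. v \<rightarrow>\<^sup>*\<^bsub>G\<^esub> w} = k" and "verts G \<noteq> {}"
  shows "Digraph_Component.connected G \<longleftrightarrow> k = card (verts G)"
proof -
  have sub: "{w. v \<rightarrow>\<^sup>*\<^bsub>G\<^esub> w} \<subseteq> verts G" for v by (auto elim: reachable_in_vertsE)
  have "k = card (verts G) \<longleftrightarrow> (\<forall>v\<in>verts G. {w. v \<rightarrow>\<^sup>*\<^bsub>G\<^esub> w} = verts G)"
    using assms sub card_subset_eq[OF finite_verts sub] by (metis ex_in_conv)
  also have "\<dots> \<longleftrightarrow> (\<forall>u\<in>verts G. \<forall>v\<in>verts G. u \<rightarrow>\<^sup>*\<^bsub>G\<^esub> v)"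
    using sub by blast
  finally show ?thesis using assms(2) by (simp add: connected_iff_reachable)
qed

end

section \<open>Additive spans\<close>

text \<open>
  A constant of its own keeps the simplifier from rewriting the record \<open>add_monoid Fq\<close> inside a span.
\<close>

definition add_span :: "'a::field set \<Rightarrow> 'a set" where
  "add_span A = generate (add_monoid Fq) A"

lemma group_add_Fq: "group (add_monoid (Fq :: 'a::field ring))"
proof -
  interpret field "Fq :: 'a ring" by (rule field_from_type_algebra)
  show ?thesis by (rule a_group)
qed

lemma add_Fq_inv [simp]: "inv\<^bsub>add_monoid Fq\<^esub> x = - (x::'a::field)"
  by (rule group.inv_equality[OF group_add_Fq]) (simp_all add: ring_of_type_algebra_def)

lemma add_span_0: "0 \<in> add_span A"
  using generate.one[of "add_monoid Fq"] by (simp add: add_span_def)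

lemma add_span_incl: "x \<in> A \<Longrightarrow> x \<in> add_span A"
  unfolding add_span_def by (rule generate.incl)

lemma add_span_add: "x \<in> add_span A \<Longrightarrow> y \<in> add_span A \<Longrightarrow> x + y \<in> add_span A"
  using generate.eng[of x "add_monoid Fq" A y] by (simp add: add_span_def)

lemma add_span_minus: "x \<in> add_span A \<Longrightarrow> - x \<in> add_span A"
  using group.generate_m_inv_closed[OF group_add_Fq, of A x]
  by (simp only: add_span_def add_Fq_inv) simp

lemma add_span_diff: "x \<in> add_span A \<Longrightarrow> y \<in> add_span A \<Longrightarrow> x - y \<in> add_span A"
  using add_span_add[of x A "- y"] add_span_minus[of y A] by simp

lemma add_span_induct [consumes 1, case_names zero incl minus add]:
  assumes "x \<in> add_span A" "Q 0" "\<And>x. x \<in> A \<Longrightarrow> Q x" "\<And>x. x \<in> A \<Longrightarrow> Q (- x)"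
    "\<And>x y. x \<in> add_span A \<Longrightarrow> Q x \<Longrightarrow> y \<in> add_span A \<Longrightarrow> Q y \<Longrightarrow> Q (x + y)"
  shows "Q x"
  using assms(1) unfolding add_span_def
proof (induction rule: generate.induct)
  case (inv x)
  then show ?case using assms(4) by (simp only: add_Fq_inv)
next
  case (eng x y)
  then show ?case using assms(5)[of x y] by (simp add: add_span_def)
qed (use assms in auto)

lemma add_span_least:
  assumes "\<And>x. x \<in> A \<Longrightarrow> x \<in> add_span B"
  shows "add_span A \<subseteq> add_span B"
proof
  fix x assume "x \<in> add_span A"
  then show "x \<in> add_span B"
    by (induction rule: add_span_induct) (auto intro: assms add_span_0 add_span_minus add_span_add)
qed

lemma add_span_image:
  assumes add: "\<And>x y. g (x + y) = g x + g (y :: 'a::field)"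
  shows "add_span (g ` A) = g ` add_span A"
proof -
  have 0: "g 0 = 0" using add[of 0 0] by (metis add.right_neutral add_left_cancel)
  have minus: "g (- x) = - g x" for x
    using add[of "- x" x] 0 by (simp add: eq_neg_iff_add_eq_0)
  show ?thesis
  proof (intro equalityI subsetI)
    fix y assume "y \<in> add_span (g ` A)"
    then show "y \<in> g ` add_span A"
    proof (induction rule: add_span_induct)
      case zero
      then show ?case using 0 add_span_0 by (intro image_eqI[of _ _ 0]) auto
    next
      case (incl x)
      then show ?case by (auto intro: add_span_incl)
    next
      case (minus x)
      then show ?case by (force simp: \<open>\<And>x. g (- x) = - g x\<close>[symmetric] intro: add_span_minus add_span_incl)
    next
      case (add x y)
      then show ?case by (force simp: assms[symmetric] intro: add_span_add)
    qed
  next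
    fix y assume "y \<in> g ` add_span A"
    then obtain x where x: "x \<in> add_span A" "y = g x" by blast
    from x(1) have "g x \<in> add_span (g ` A)"
      by (induction rule: add_span_induct)
        (auto simp: 0 minus add intro: add_span_0 add_span_minus add_span_add add_span_incl)
    then show "y \<in> add_span (g ` A)" using x by simp
  qed
qed

definition differences :: "'a::minus set \<Rightarrow> 'a set" where
  "differences A = {a - b | a b. a \<in> A \<and> b \<in> A}"

lemma T1_tilde_eq:
  assumes "1 \<in> P"
  shows "T1_tilde P = add_span (differences P)"
  unfolding T1_tilde_def add_span_def[symmetric]
proof
  show "add_span {a - 1 |a. a \<in> P} \<subseteq> add_span (differences P)"
    using assms
    by (intro add_span_least) (auto simp: differences_def intro!: add_span_incl)
  show "add_span (differences P) \<subseteq> add_span {a - 1 |a. a \<in> P}"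
  proof (intro add_span_least)
    fix x assume "x \<in> differences P"
    then obtain a b where "a \<in> P" "b \<in> P" "x = (a - 1) - (b - 1)" by (auto simp: differences_def)
    moreover from this have "a - 1 \<in> add_span {a - 1 |a. a \<in> P}" "b - 1 \<in> add_span {a - 1 |a. a \<in> P}"
      by (auto intro!: add_span_incl)
    ultimately show "x \<in> add_span {a - 1 |a. a \<in> P}" by (simp only: add_span_diff)
  qed
qed

lemma T2_tilde_eq: "T2_tilde P = add_span P"
  by (simp only: T2_tilde_def add_span_def)

lemma card_translation_maps: "card (translation_maps T) = card (T :: 'a::field set)"
proof -
  have "translation_maps T = (\<lambda>c. tau 1 c id) ` T" by (auto simp: translation_maps_def)
  moreover have "inj_on (\<lambda>c::'a. tau 1 c id) T"
    by (rule inj_onI) (auto simp: tau_def dest: fun_cong[of _ _ 0])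
  ultimately show ?thesis by (simp add: card_image)
qed

section \<open>The flag graph in coordinates\<close>

text \<open>
  The flag with coordinates \<open>(x, A)\<close>: the translate by \<open>x\<close> of the flag of \<open>0\<close> and \<open>A \<union> {0}\<close>.
\<close>

definition flag_at :: "'a::plus \<Rightarrow> 'a set \<Rightarrow> 'a \<times> 'a set" where
  "flag_at x A = (x, insert x ((+) x ` A))"

context affine_block
begin

definition flag_set :: "('a \<times> 'a set) set" where
  "flag_set = flag_orbit G (0, P \<union> {0})"

text \<open>
  This is \<open>flag_graph D flag_set (Xi flag_set)\<close> for every design \<open>D\<close>; fixing it without \<open>D\<close> lets it
  serve as the parameter of a locale interpretation.
\<close>

definition orbit_graph :: "('a \<times> 'a set, ('a \<times> 'a set) \<times> ('a \<times> 'a set)) pre_digraph" where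
  "orbit_graph = with_proj \<lparr>pverts = flag_set, parcs = Xi flag_set\<rparr>"

text \<open>
  Since \<open>G\<close> contains the translations, each of its elements is an element of \<open>G\<^sub>0\<close> followed by
  a translation.
\<close>

lemma flag_set_eq: "flag_set = (\<lambda>(x, A). flag_at x A) ` (UNIV \<times> blocks)"
proof (intro Set.set_eqI iffI)
  fix v assume "v \<in> flag_set"
  then obtain g where g: "g \<in> G" "v = (g 0, g ` (P \<union> {0}))"
    by (auto simp: flag_set_def flag_orbit_def)
  \<comment> \<open>The part of \<open>g\<close> that fixes \<open>0\<close>.\<close>
  define h where "h = (\<lambda>z. z + - g 0) \<circ> g"
  have "h \<in> G" unfolding h_def using translation_mem g by (intro G_comp)
  then have h: "h \<in> stab0 G" by (simp add: stab0_def h_def)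
  have "(+) (g 0) ` (h ` P) = g ` P" by (simp add: image_image h_def)
  then have "v = flag_at (g 0) (h ` P)" using g by (simp add: flag_at_def)
  then show "v \<in> (\<lambda>(x, A). flag_at x A) ` (UNIV \<times> blocks)"
    using h by (auto simp: blocks_def intro!: image_eqI[of _ _ "(g 0, h ` P)"])
next
  fix v assume "v \<in> (\<lambda>(x, A). flag_at x A) ` (UNIV \<times> blocks)"
  then obtain x h where h: "h \<in> stab0 G" "v = flag_at x (h ` P)" by (auto simp: blocks_def)
  define g where "g = (\<lambda>z. z + x) \<circ> h"
  have "g \<in> G" unfolding g_def using translation_mem h by (intro G_comp) (auto simp: stab0_def)
  moreover have "v = (g 0, g ` (P \<union> {0}))"
    using stab0_0[OF h(1)] by (auto simp: h(2) flag_at_def g_def image_image add.commute)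
  ultimately show "v \<in> flag_set" by (auto simp: flag_set_def flag_orbit_def)
qed

lemma flag_set_cases:
  assumes "v \<in> flag_set"
  obtains x A where "A \<in> blocks" "v = flag_at x A"
  using assms by (auto simp: flag_set_eq)

lemma flag_at_mem: "A \<in> blocks \<Longrightarrow> flag_at x A \<in> flag_set"
  by (auto simp: flag_set_eq)

lemma flag_at_eq_iff:
  assumes "A \<in> blocks" "B \<in> blocks"
  shows "flag_at x A = flag_at y B \<longleftrightarrow> x = y \<and> A = B"
proof
  assume eq: "flag_at x A = flag_at y B"
  then have "x = y" and ins: "insert x ((+) x ` A) = insert x ((+) x ` B)" by (auto simp: flag_at_def)
  moreover have "x \<notin> (+) x ` A" "x \<notin> (+) x ` B" using block_nonzero assms by auto
  ultimately have "(+) x ` A = (+) x ` B" by (metis Diff_insert_absorb)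
  then show "x = y \<and> A = B" using \<open>x = y\<close> by (simp add: inj_image_eq_iff)
qed simp

lemma card_flag_set: "card flag_set = q * card blocks"
proof -
  have "inj_on (\<lambda>(x, A). flag_at x A) (UNIV \<times> blocks)" by (auto simp: inj_on_def flag_at_eq_iff)
  then show ?thesis by (simp add: flag_set_eq card_image card_cartesian_product card_F)
qed

text \<open>
  For adjacent flags over \<open>x\<close> and \<open>y\<close> the second block contains \<open>x - y\<close>, as does the block \<open>-A\<close>;
  distinct blocks being disjoint, the second block is \<open>-A\<close>.
\<close>

lemma flag_arc_iff:
  assumes "A \<in> blocks" "B \<in> blocks"
  shows "(flag_at x A, flag_at y B) \<in> Xi flag_set \<longleftrightarrow> y - x \<in> A \<and> B = uminus ` A"
proof
  have mem: "z \<in> (+) w ` C \<longleftrightarrow> z - w \<in> C" for z w :: 'a and C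
    by (auto simp: image_iff algebra_simps intro: bexI[of _ "z - w"])
  show "y - x \<in> A \<and> B = uminus ` A" if "(flag_at x A, flag_at y B) \<in> Xi flag_set"
  proof -
    from that have "y - x \<in> A" "x - y \<in> B" by (auto simp: Xi_def flag_at_def mem)
    moreover from this have "x - y \<in> uminus ` A" by (auto intro!: image_eqI[of _ _ "y - x"])
    ultimately show ?thesis using blocks_disjoint[OF assms(2) uminus_mem_blocks[OF assms(1)]] by blast
  qed
  assume *: "y - x \<in> A \<and> B = uminus ` A"
  then have "x - y \<in> B" by (auto intro!: image_eqI[of _ _ "y - x"])
  moreover have "x \<noteq> y" using * block_nonzero[OF assms(1)] by auto
  ultimately show "(flag_at x A, flag_at y B) \<in> Xi flag_set"
    using * flag_at_mem[OF assms(1), of x] flag_at_mem[OF assms(2), of y]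
    by (simp add: Xi_def flag_at_def mem)
qed

sublocale flags: pseudo_graph orbit_graph
proof -
  interpret pair_pseudo_graph "\<lparr>pverts = flag_set, parcs = Xi flag_set\<rparr>"
  proof
    show "symmetric (with_proj \<lparr>pverts = flag_set, parcs = Xi flag_set\<rparr>)"
      using symmetric_flag_graph[of undefined flag_set] by (simp add: flag_graph_def)
  qed (auto simp: Xi_def)
  show "pseudo_graph orbit_graph" unfolding orbit_graph_def by unfold_locales
qed

lemma verts_orbit_graph [simp]: "verts orbit_graph = flag_set"
  by (simp add: orbit_graph_def)

lemma arcs_ends_orbit_graph [simp]: "arcs_ends orbit_graph = Xi flag_set"
  by (auto simp: orbit_graph_def arcs_ends_def arc_to_ends_def)

lemma flag_step:
  assumes "A \<in> blocks" "a \<in> A"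
  shows "flag_at x A \<rightarrow>\<^sup>*\<^bsub>orbit_graph\<^esub> flag_at (x + a) (uminus ` A)"
  by (rule flags.reachable_adjI) (use assms uminus_mem_blocks in \<open>simp add: flag_arc_iff\<close>)

lemma uminus_uminus_image [simp]: "uminus ` uminus ` A = (A :: 'a set)"
  by (simp add: image_image)

lemma flag_reachable_differences:
  assumes A: "A \<in> blocks" and u: "u \<in> add_span (differences A)"
  shows "flag_at x A \<rightarrow>\<^sup>*\<^bsub>orbit_graph\<^esub> flag_at (x + u) A"
proof -
  have two_steps: "flag_at x A \<rightarrow>\<^sup>*\<^bsub>orbit_graph\<^esub> flag_at (x + (a - b)) A" if "a \<in> A" "b \<in> A" for a b x
    using flags.reachable_trans[OF flag_step[OF A that(1), of x]
        flag_step[OF uminus_mem_blocks[OF A] imageI[OF that(2)], of "x + a"]]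
    by (simp add: algebra_simps)
  from u have "\<forall>x. flag_at x A \<rightarrow>\<^sup>*\<^bsub>orbit_graph\<^esub> flag_at (x + u) A"
  proof (induction rule: add_span_induct)
    case zero
    show ?case using flag_at_mem[OF A] by simp
  next
    case (incl u)
    then show ?case using two_steps by (auto simp: differences_def)
  next
    case (minus u)
    then obtain a b where "a \<in> A" "b \<in> A" "- u = b - a" by (auto simp: differences_def)
    then show ?case using two_steps by simp
  next
    case (add u v)
    then show ?case by (metis add.assoc flags.reachable_trans)
  qed
  then show ?thesis by blast
qed

text \<open>
  Each step moves the flag between the two families on the right-hand side: from \<open>A\<close> to \<open>-A\<close> it adds
  an element of \<open>A\<close>, which is \<open>a\<close> up to a difference, and from \<open>-A\<close> back to \<open>A\<close> it subtracts one.
\<close>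

lemma flag_component:
  assumes A: "A \<in> blocks" and a: "a \<in> A"
  shows "{w. flag_at x A \<rightarrow>\<^sup>*\<^bsub>orbit_graph\<^esub> w} =
    (\<lambda>u. flag_at (x + u) A) ` add_span (differences A) \<union>
    (\<lambda>u. flag_at (x + a + u) (uminus ` A)) ` add_span (differences A)" (is "?L = ?V1 \<union> ?V2")
proof (intro equalityI subsetI)
  let ?T = "add_span (differences A)"
  have A': "uminus ` A \<in> blocks" using A by (rule uminus_mem_blocks)
  fix w assume "w \<in> ?L"
  then have "flag_at x A \<rightarrow>\<^sup>*\<^bsub>orbit_graph\<^esub> w" by simp
  then show "w \<in> ?V1 \<union> ?V2"
  proof (induction rule: flags.reachable_induct)
    case base
    then show ?case using add_span_0 by (auto intro!: image_eqI[of _ _ 0])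
  next
    case (step v w)
    have arc: "(v, w) \<in> Xi flag_set" using step by simp
    then have "w \<in> flag_set" by (auto simp: Xi_def)
    then obtain y B where w: "B \<in> blocks" "w = flag_at y B" by (rule flag_set_cases)
    from step(3) show ?case
    proof
      assume "v \<in> ?V1"
      then obtain u where u: "u \<in> ?T" "v = flag_at (x + u) A" by blast
      then have y: "y - (x + u) \<in> A" "B = uminus ` A" using arc w A by (auto simp: flag_arc_iff)
      have "y - (x + u) - a \<in> ?T" using y a by (intro add_span_incl) (auto simp: differences_def)
      then have "u + (y - (x + u) - a) \<in> ?T" using u by (intro add_span_add)
      moreover have "y = x + a + (u + (y - (x + u) - a))" by simp
      ultimately have "w \<in> ?V2"
        using w y by (intro image_eqI[of _ _ "u + (y - (x + u) - a)"]) simp_all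
      then show ?case by blast
    next
      assume "v \<in> ?V2"
      then obtain u where u: "u \<in> ?T" "v = flag_at (x + a + u) (uminus ` A)" by blast
      then have y: "y - (x + a + u) \<in> uminus ` A" "B = A" using arc w A' by (auto simp: flag_arc_iff)
      then obtain b where b: "b \<in> A" "y - (x + a + u) = - b" by blast
      have "a - b \<in> ?T" using b a by (intro add_span_incl) (auto simp: differences_def)
      then have "u + (a - b) \<in> ?T" using u by (intro add_span_add)
      moreover have "y = x + (u + (a - b))" using b by (simp add: algebra_simps)
      ultimately have "w \<in> ?V1"
        using w y by (intro image_eqI[of _ _ "u + (a - b)"]) simp_all
      then show ?case by blast
    qed
  qed
next
  let ?T = "add_span (differences A)"
  fix w assume "w \<in> ?V1 \<union> ?V2"
  then show "w \<in> ?L"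
  proof
    assume "w \<in> ?V1"
    then show ?thesis using flag_reachable_differences[OF A] by auto
  next
    assume "w \<in> ?V2"
    then obtain u where u: "u \<in> ?T" "w = flag_at (x + a + u) (uminus ` A)" by blast
    have "flag_at x A \<rightarrow>\<^sup>*\<^bsub>orbit_graph\<^esub> flag_at (x + u) A" using u by (intro flag_reachable_differences A)
    also have "flag_at (x + u) A \<rightarrow>\<^sup>*\<^bsub>orbit_graph\<^esub> flag_at (x + u + a) (uminus ` A)" using A a by (rule flag_step)
    finally show ?thesis using u by (simp add: add_ac)
  qed
qed

text \<open>Blocks are images of \<open>P\<close> under elements of \<open>G\<^sub>0\<close>, which are additive bijections.\<close>

lemma card_add_span_block:
  assumes "A \<in> blocks"
  shows "card (add_span (differences A)) = card (T1_tilde P)" "card (add_span A) = card (T2_tilde P)"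
proof -
  obtain g where g: "g \<in> stab0 G" "A = g ` P" using assms by (auto simp: blocks_def)
  have inj: "inj_on g S" for S using stab0_bij[OF g(1)] by (meson bij_is_inj inj_on_subset subset_UNIV)
  have gd: "g (x - y) = g x - g y" for x y
    using stab0_add[OF g(1), of x "- y"] stab0_minus[OF g(1)] by simp
  have "differences A = g ` differences P"
    unfolding differences_def g(2) by (auto simp: image_iff gd[symmetric]) (metis gd)+
  then show "card (add_span (differences A)) = card (T1_tilde P)"
    using add_span_image[of g, OF stab0_add[OF g(1)]] inj by (simp add: T1_tilde_eq[OF one_in_P] card_image)
  show "card (add_span A) = card (T2_tilde P)"
    using card_image[OF inj, of "add_span P"]
    by (simp add: g(2) add_span_image[of g, OF stab0_add[OF g(1)]] T2_tilde_eq)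
qed

lemma block_symmetric_iff:
  assumes "A \<in> blocks"
  shows "uminus ` A = A \<longleftrightarrow> uminus ` P = P"
proof -
  obtain g where g: "g \<in> stab0 G" "A = g ` P" using assms by (auto simp: blocks_def)
  have "uminus ` A = g ` uminus ` P" by (simp add: g(2) image_image stab0_minus[OF g(1)])
  then show ?thesis
    using stab0_bij[OF g(1)] by (simp add: g(2) inj_image_eq_iff bij_is_inj)
qed

lemma block_nonempty: "A \<in> blocks \<Longrightarrow> A \<noteq> {}"
  using one_in_P by (auto simp: blocks_def)

text \<open>
  The two families in \<open>flag_component\<close> lie over the blocks \<open>A\<close> and \<open>-A\<close>, which are distinct
  together with \<open>P\<close> and \<open>-P\<close>.
\<close>

lemma card_component_asymmetric:
  assumes "P \<noteq> uminus ` P" "v \<in> flag_set"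
  shows "card {w. v \<rightarrow>\<^sup>*\<^bsub>orbit_graph\<^esub> w} = 2 * card (T1_tilde P)"
proof -
  obtain x A where A: "A \<in> blocks" "v = flag_at x A" using assms by (elim flag_set_cases)
  obtain a where a: "a \<in> A" using block_nonempty[OF A(1)] by blast
  let ?T = "add_span (differences A)"
  have A': "uminus ` A \<in> blocks" "uminus ` A \<noteq> A"
    using A assms by (auto simp: uminus_mem_blocks block_symmetric_iff)
  have "inj_on (\<lambda>u. flag_at (x + u) A) ?T" "inj_on (\<lambda>u. flag_at (x + a + u) (uminus ` A)) ?T"
    using A A' by (auto simp: inj_on_def flag_at_eq_iff)
  moreover have "(\<lambda>u. flag_at (x + u) A) ` ?T \<inter> (\<lambda>u. flag_at (x + a + u) (uminus ` A)) ` ?T = {}"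
  proof -
    have "flag_at y A \<noteq> flag_at z (uminus ` A)" for y z
      using A A'(2)[symmetric] by (simp add: flag_at_eq_iff[OF A(1) A'(1)])
    then show ?thesis unfolding disjoint_iff by (metis (no_types, lifting) imageE)
  qed
  ultimately show ?thesis
    unfolding A(2) flag_component[OF A(1) a] using A
    by (subst card_Un_disjoint) (auto simp: card_image card_add_span_block)
qed

text \<open>
  Here both families lie over \<open>A\<close>, and together they form the span of \<open>A\<close>: modulo the span \<open>T\<close> of
  the differences all elements of \<open>A\<close> agree with \<open>a\<close>, and \<open>2 a = a - (-a)\<close> lies in \<open>T\<close>, so the span
  of \<open>A\<close> is \<open>T\<close> together with the coset \<open>a + T\<close>.
\<close>

lemma card_component_symmetric:
  assumes "P = uminus ` P" "v \<in> flag_set"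
  shows "card {w. v \<rightarrow>\<^sup>*\<^bsub>orbit_graph\<^esub> w} = card (T2_tilde P)"
proof -
  obtain x A where A: "A \<in> blocks" "v = flag_at x A" using assms by (elim flag_set_cases)
  obtain a where a: "a \<in> A" using block_nonempty[OF A(1)] by blast
  let ?T = "add_span (differences A)"
  have sym: "uminus ` A = A" using A assms by (simp add: block_symmetric_iff)
  have neg: "- b \<in> A" if "b \<in> A" for b using that sym by blast
  have sub: "?T \<subseteq> add_span A"
    by (rule add_span_least) (auto simp: differences_def intro: add_span_diff add_span_incl)
  have "add_span A \<subseteq> ?T \<union> (+) a ` ?T"
  proof
    have diff: "b - c \<in> ?T" if "b \<in> A" "c \<in> A" for b c
      using that by (auto simp: differences_def intro: add_span_incl)
    have coset: "z \<in> (+) a ` ?T" if "z - a \<in> ?T" for z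
      using that by (intro image_eqI[of _ _ "z - a"]) auto
    have 2: "a + a \<in> ?T" using diff[OF a neg[OF a]] by simp
    fix z assume "z \<in> add_span A"
    then show "z \<in> ?T \<union> (+) a ` ?T"
    proof (induction rule: add_span_induct)
      case zero
      then show ?case using add_span_0 by blast
    next
      case (incl z)
      then show ?case using coset diff a by simp
    next
      case (minus z)
      then show ?case using coset diff[OF neg a, of z] by simp
    next
      case (add y z)
      show ?case
      proof (cases "y \<in> ?T"; cases "z \<in> ?T")
        assume "y \<in> ?T" "z \<in> ?T"
        then show ?thesis using add_span_add by blast
      next
        assume "y \<in> ?T" "z \<notin> ?T"
        then obtain t where "t \<in> ?T" "z = a + t" using add by blast
        then show ?thesis using add_span_add[OF \<open>y \<in> ?T\<close>, of t] by (auto intro!: coset simp: algebra_simps)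
      next
        assume "y \<notin> ?T" "z \<in> ?T"
        then obtain t where "t \<in> ?T" "y = a + t" using add by blast
        then show ?thesis using add_span_add[OF \<open>z \<in> ?T\<close>, of t] by (auto intro!: coset simp: algebra_simps)
      next
        assume "y \<notin> ?T" "z \<notin> ?T"
        then obtain s t where "s \<in> ?T" "y = a + s" "t \<in> ?T" "z = a + t" using add by blast
        then show ?thesis using add_span_add[OF 2 add_span_add[of s _ t]] by (simp add: add_ac)
      qed
    qed
  qed
  moreover have "?T \<union> (+) a ` ?T \<subseteq> add_span A"
    using sub a by (auto intro: add_span_add add_span_incl)
  ultimately have span: "add_span A = ?T \<union> (+) a ` ?T" by blast
  have "{w. v \<rightarrow>\<^sup>*\<^bsub>orbit_graph\<^esub> w} = (\<lambda>u. flag_at (x + u) A) ` add_span A"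
    unfolding A(2) flag_component[OF A(1) a] sym span image_Un image_image by (simp add: add.assoc)
  moreover have "inj_on (\<lambda>u. flag_at (x + u) A) (add_span A)"
    using A by (auto simp: inj_on_def flag_at_eq_iff)
  ultimately show ?thesis using A by (simp add: card_image card_add_span_block)
qed

lemma valency_orbit_graph:
  assumes "v \<in> flag_set"
  shows "out_degree orbit_graph v = card P"
proof -
  obtain x A where A: "A \<in> blocks" "v = flag_at x A" using assms by (elim flag_set_cases)
  have A': "uminus ` A \<in> blocks" using A(1) by (rule uminus_mem_blocks)
  have "out_arcs orbit_graph v = (\<lambda>a. (v, flag_at (x + a) (uminus ` A))) ` A"
  proof (intro Set.set_eqI iffI)
    fix e assume "e \<in> out_arcs orbit_graph v"
    then obtain w where e: "e = (v, w)" "(v, w) \<in> Xi flag_set" by (cases e) (auto simp: orbit_graph_def)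
    then have "w \<in> flag_set" by (auto simp: Xi_def)
    then obtain y B where w: "B \<in> blocks" "w = flag_at y B" by (rule flag_set_cases)
    then have "y - x \<in> A" "B = uminus ` A" using e A by (auto simp: flag_arc_iff)
    then show "e \<in> (\<lambda>a. (v, flag_at (x + a) (uminus ` A))) ` A"
      using e w by (intro image_eqI[of _ _ "y - x"]) auto
  next
    fix e assume "e \<in> (\<lambda>a. (v, flag_at (x + a) (uminus ` A))) ` A"
    then show "e \<in> out_arcs orbit_graph v" using A A' by (auto simp: orbit_graph_def flag_arc_iff)
  qed
  moreover have "inj_on (\<lambda>a. (v, flag_at (x + a) (uminus ` A))) A"
    using A' by (auto simp: inj_on_def flag_at_eq_iff)
  ultimately show ?thesis using A by (simp add: out_degree_def card_image block_card)
qed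

end

section \<open>Connected flag graphs\<close>

context affine_block
begin

lemma two_le_card_blocks:
  assumes "card P < q - 1"
  shows "2 \<le> card blocks"
proof (rule ccontr)
  assume "\<not> ?thesis"
  then have "card blocks = 0 \<or> card blocks = 1" by linarith
  then show False using card_blocks_times_card_P q_gt_1 assms by auto
qed

lemma flag_set_nonempty: "flag_set \<noteq> {}"
  using flag_at_mem[OF P_mem_blocks] by blast

text \<open>
  The quadratic character \<open>x \<mapsto> x\<^bsup>(q - 1) / 2\<^esup>\<close> takes the values \<open>1\<close> and \<open>-1\<close> only and is invariant under
  the Frobenius map.  If the stabilizer of \<open>P\<close>, which is transitive on \<open>P\<close>, sent \<open>1\<close> to a non-square
  by a map \<open>f\<close>, composition with \<open>f\<close> would exchange the maps with \<open>h 1\<close> a square and those with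
  \<open>h 1\<close> a non-square, and the stabilizer would have even order.
\<close>

lemma block_eq_squares:
  assumes half: "q - 1 = 2 * card P" and "odd p" and odd: "odd (card (stab0_set G P))"
  shows "P = {x. x ^ card P = 1}"
proof -
  let ?n = "card P"
  have n: "?n > 0" using half q_gt_1 by simp
  have pm: "x ^ ?n = 1 \<or> x ^ ?n = - 1" if "x \<noteq> 0" for x :: 'a
  proof -
    have "(x ^ ?n) ^ 2 = 1" using power_q_minus_1[OF that] half by (simp add: power_mult[symmetric] mult.commute)
    then show ?thesis by (simp add: power2_eq_1_iff)
  qed
  have ne: "(1::'a) \<noteq> - 1"
  proof
    assume "(1::'a) = - 1"
    then have "of_nat 2 = (0::'a)" by (simp add: eq_neg_iff_add_eq_0)
    then have "p dvd 2" using of_nat_eq_0_iff_char_dvd[where 'a = 'a, of 2] CHAR_F by simp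
    then have "p \<le> 2" by (intro dvd_imp_le) auto
    then have "p = 2" using p_gt_1 by simp
    then show False using \<open>odd p\<close> by simp
  qed
  have nz: "x \<noteq> 0" if "x \<in> P" for x using that block_nonzero[OF P_mem_blocks] by auto
  have P1: "f 1 \<in> P" if "f \<in> stab0_set G P" for f using that orbit_of_1 by blast
  have sub: "P \<subseteq> {x. x ^ ?n = 1}"
  proof (rule ccontr)
    assume "\<not> ?thesis"
    then obtain x where x: "x \<in> P" "x ^ ?n \<noteq> 1" by blast
    have "x \<in> (\<lambda>g. g 1) ` stab0_set G P" using x(1) unfolding orbit_of_1 .
    then obtain f where f: "f \<in> stab0_set G P" "f 1 = x" by blast
    have x': "x ^ ?n = - 1" using pm[OF nz[OF x(1)]] x(2) by blast
    obtain a j where aj: "a \<noteq> 0" "f = t_map p a j" using G0P.semilinear[OF f(1)] by blast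
    have flip: "(f (h 1)) ^ ?n = - ((h 1) ^ ?n)" if "h \<in> stab0_set G P" for h
    proof -
      have "(f (h 1)) ^ ?n = x ^ ?n * ((h 1) ^ ?n) ^ (p ^ j)"
        using f(2) by (simp add: aj t_map_eq power_mult_distrib power_mult[symmetric] mult.commute)
      also have "((h 1) ^ ?n) ^ (p ^ j) = (h 1) ^ ?n"
        using pm[OF nz[OF P1[OF that]]] \<open>odd p\<close> by auto
      finally show ?thesis using x' by simp
    qed
    have comp: "f \<circ> h \<in> stab0_set G P" if "h \<in> stab0_set G P" for h
      using perm_groupD(2)[OF G0P.perm_group f(1) that] .
    have inj: "inj_on ((\<circ>) f) S" for S
      using perm_groupD(3)[OF G0P.perm_group f(1)]
      by (auto simp: inj_on_def fun_eq_iff bij_def dest: injD)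
    define Q where "Q = {h \<in> stab0_set G P. (h 1) ^ ?n = 1}"
    have "card Q \<le> card (stab0_set G P - Q)"
      using flip comp ne by (intro card_inj_on_le[OF inj]) (auto simp: Q_def)
    moreover have "card (stab0_set G P - Q) \<le> card Q"
    proof (intro card_inj_on_le[OF inj] subsetI)
      fix g assume "g \<in> (\<circ>) f ` (stab0_set G P - Q)"
      then obtain h where h: "h \<in> stab0_set G P" "(h 1) ^ ?n \<noteq> 1" "g = f \<circ> h" by (auto simp: Q_def)
      then have "(h 1) ^ ?n = - 1" using pm[OF nz[OF P1]] by blast
      then show "g \<in> Q" using h flip comp by (simp add: Q_def)
    qed simp
    moreover have "card (stab0_set G P - Q) = card (stab0_set G P) - card Q"
      by (rule card_Diff_subset) (auto simp: Q_def)
    moreover have "card Q \<le> card (stab0_set G P)" by (rule card_mono) (auto simp: Q_def)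
    ultimately have "card (stab0_set G P) = 2 * card Q" by linarith
    then show False using odd by simp
  qed
  moreover have "card {x::'a. x ^ ?n = 1} \<le> ?n" using n by (rule card_power_eq_le)
  ultimately show ?thesis by (intro card_seteq) auto
qed

lemma index_of_subgroup:
  assumes "subgroup P (Fq_mult :: 'a monoid)"
  shows "card (rcosets\<^bsub>Fq_mult\<^esub> P) * card P = q - 1"
  using group.lagrange[OF group_Fq_mult assms] card_nonzero by (simp add: Coset.order_def)

lemma odd_p_if_half:
  assumes "q - 1 = 2 * card P"
  shows "odd p"
proof
  assume "even p"
  then have "even q" using d_pos by (simp add: q_eq)
  then show False using assms q_gt_1 by (metis even_diff_nat dvd_triv_left even_add less_imp_le odd_one le_add_diff_inverse2)
qed

text \<open>
  With only two blocks \<open>P \<noteq> -P\<close>, the scalar \<open>-1\<close> does not fix \<open>P\<close>, so that the scalars fixing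
  \<open>P\<close> have odd order.  Since \<open>(q - 1) / 2\<close> divides the order of the stabilizer of \<open>P\<close>, its
  \<open>2\<close>-part divides \<open>d\<close>; this is possible for odd \<open>d\<close> and \<open>q \<equiv> 3 mod 4\<close> only.
\<close>

lemma half_block_imp:
  assumes half: "q - 1 = 2 * card P" and asym: "P \<noteq> uminus ` P"
  shows "[int p = - 1] (mod 4)" "odd d" "subgroup P (Fq_mult :: 'a monoid)"
    "card (rcosets\<^bsub>Fq_mult\<^esub> P) = 2"
proof -
  have "odd p" using odd_p_if_half[OF half] .
  have K: "odd (card (scalars p (stab0_set G P)))"
  proof
    assume "even (card (scalars p (stab0_set G P)))"
    then have "- 1 \<in> scalars p (stab0_set G P)"
      using minus_1_mem_if_even_card[OF G0P.scalars_closed] by blast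
    then have "t_map p (- 1) 0 ` P = P" by (simp add: scalars_def stab0_set_def)
    moreover have "t_map p (- 1) 0 = (uminus :: 'a \<Rightarrow> 'a)" by (rule ext) (simp add: t_map_eq)
    ultimately show False using asym by simp
  qed
  have two: "2 ^ k dvd d" if "2 ^ k dvd card P" for k
    using G0P.two_power_dvd_d[OF K] that card_P_dvd dvd_trans by blast
  show "odd d"
  proof
    assume "even d"
    let ?k = "multiplicity 2 d"
    have "?k > 0" using \<open>even d\<close> d_pos by (simp add: prime_multiplicity_gt_zero_iff)
    \<comment> \<open>For even \<open>d\<close> the \<open>2\<close>-part of \<open>q - 1\<close> is at least four times that of \<open>d\<close>, so passing to
       \<open>(q - 1) / 2\<close> still leaves a factor too much.\<close>
    then have "2 * 2 ^ Suc ?k dvd 2 * card P"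
      using two_part_of_power_minus_1(2)[OF \<open>odd p\<close> multiplicity_dvd, of d] half by (simp add: q_eq)
    then have "2 ^ Suc ?k dvd d" by (intro two) simp
    then show False using d_pos multiplicity_geI[of d 2 "Suc ?k"] by simp
  qed
  have "odd (card P)" using two[of 1] \<open>odd d\<close> by auto
  have "q mod 4 = 3"
  proof -
    obtain m where "card P = 2 * m + 1" using \<open>odd (card P)\<close> by (elim oddE)
    then have "q = 4 * m + 3" using half q_gt_1 by simp
    then show ?thesis by presburger
  qed
  have "p mod 4 = 3"
  proof (rule ccontr)
    assume "p mod 4 \<noteq> 3"
    then have "p mod 4 = 1" using \<open>odd p\<close> by presburger
    then have "q mod 4 = 1" using power_mod[of p 4 d] by (simp add: q_eq)
    then show False using \<open>q mod 4 = 3\<close> by simp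
  qed
  then have "int p mod 4 = 3" by presburger
  then show "[int p = - 1] (mod 4)" by (simp add: cong_def)
  have "odd (card (stab0_set G P))"
    using G0P.two_power_dvd_d[OF K, of 1] \<open>odd d\<close> by auto
  then have P: "P = {x. x ^ card P = 1}" using half \<open>odd p\<close> by (intro block_eq_squares)
  show sub: "subgroup P (Fq_mult :: 'a monoid)"
  proof (rule subgroup_Fq_multI)
    show "0 \<notin> P" using block_nonzero[OF P_mem_blocks] .
    show "1 \<in> P" by (rule one_in_P)
    show "x * y \<in> P" if "x \<in> P" "y \<in> P" for x y
    proof -
      have "x ^ card P = 1" "y ^ card P = 1" using that P by blast+
      then have "(x * y) ^ card P = 1" by (simp add: power_mult_distrib)
      then show ?thesis using P by blast
    qed
  qed
  show "card (rcosets\<^bsub>Fq_mult\<^esub> P) = 2"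
    using index_of_subgroup[OF sub] half one_in_P by auto
qed

lemma half_subgroup_imp_asymmetric:
  assumes half: "q - 1 = 2 * card P" and "[int p = - 1] (mod 4)" "odd d" and sub: "subgroup P (Fq_mult :: 'a monoid)"
  shows "P \<noteq> uminus ` P"
proof
  assume sym: "P = uminus ` P"
  have "- 1 \<in> uminus ` P" using one_in_P by blast
  then have m1: "- 1 \<in> P" using sym by simp
  have "int p mod 4 = 3" using assms(2) by (simp add: cong_def)
  then have p3: "p mod 4 = 3" by presburger
  obtain k where k: "d = 2 * k + 1" using \<open>odd d\<close> by (elim oddE)
  have "p ^ 2 mod 4 = 1" using power_mod[of p 4 2] p3 by simp
  then have "(p ^ 2) ^ k mod 4 = 1" using power_mod[of "p ^ 2" 4 k] by simp
  moreover have "q = (p ^ 2) ^ k * p" by (simp only: q_eq k power_add power_mult power_one_right)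
  ultimately have "q mod 4 = 3" using p3 mod_mult_eq[of "(p ^ 2) ^ k" 4 p] by simp
  then have "odd (card P)" using half by presburger
  moreover have "(- 1 :: 'a) ^ card P = 1"
  proof (rule power_card_eq_1)
    show "0 \<notin> P" using block_nonzero[OF P_mem_blocks] .
    show "x * y \<in> P" if "x \<in> P" "y \<in> P" for x y using subgroup.m_closed[OF sub that] by simp
  qed (use m1 in auto)
  ultimately have "- 1 = (1::'a)" by simp
  then have "of_nat 2 = (0::'a)" by (metis add.right_inverse of_nat_numeral one_add_one)
  then have "p dvd 2" using of_nat_eq_0_iff_char_dvd[where 'a = 'a, of 2] CHAR_F by simp
  then have "p \<le> 2" by (intro dvd_imp_le) auto
  then show False using p3 by (auto simp: le_Suc_eq numeral_2_eq_2)
qed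

text \<open>
  The span of \<open>P - P\<close> contains \<open>P - 1\<close>, hence has at least \<open>(q - 1) / 2 > q / 3\<close> elements, as \<open>q > 3\<close>.
  A proper subgroup has order at most \<open>q / p \<le> q / 3\<close>, since \<open>p\<close> is odd.
\<close>

lemma card_T1_tilde_half:
  assumes half: "q - 1 = 2 * card P" and "1 < card P" and c: "card (T1_tilde P) = p ^ c"
  shows "card (T1_tilde P) = q"
proof -
  have "(\<lambda>a. a - 1) ` P \<subseteq> T1_tilde P"
    unfolding T1_tilde_def by (auto intro: generate.incl)
  then have "card ((\<lambda>a. a - 1) ` P) \<le> p ^ c" unfolding c[symmetric] by (intro card_mono) auto
  then have ge: "card P \<le> p ^ c" by (simp add: card_image)
  have le: "p ^ c \<le> p ^ d" using card_mono[of UNIV "T1_tilde P"] card_F by (simp add: c[symmetric] q_eq)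
  then have "c \<le> d" using p_gt_1 by simp
  then obtain r where r: "d = c + r" using le_Suc_ex by blast
  have "r = 0"
  proof (rule ccontr)
    assume "r \<noteq> 0"
    then have "p \<le> p ^ r" using p_gt_1 by (cases r) auto
    moreover have "p \<noteq> 2" using odd_p_if_half[OF half] by auto
    ultimately have "3 \<le> p ^ r" using p_gt_1 by simp
    then have "p ^ c * 3 \<le> q" by (simp add: q_eq r power_add)
    then show False using ge half assms(2) q_gt_1 by linarith
  qed
  then show ?thesis using c by (simp add: q_eq r)
qed

lemma components_and_connectedness:
  assumes "1 < card P" "card P < q - 1"
    and c1: "card (T1_tilde P) = p ^ c1" and c2: "card (T2_tilde P) = p ^ c2"
  shows "P \<noteq> uminus ` P \<Longrightarrow>
      2 * num_components orbit_graph = HK_order p G P * e_num p G P * p ^ (d - c1)"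
    and "P = uminus ` P \<Longrightarrow> num_components orbit_graph = HK_order p G P * e_num p G P * p ^ (d - c2)"
    and "Digraph_Component.connected orbit_graph \<longleftrightarrow>
      [int p = - 1] (mod 4) \<and> odd d \<and> subgroup P (Fq_mult :: 'a monoid) \<and>
      card (rcosets\<^bsub>Fq_mult\<^esub> P) = 2"
    and "Digraph_Component.connected orbit_graph \<Longrightarrow> card flag_set = 2 * q \<and> q - 1 = 2 * card P"
proof -
  have le: "card T \<le> q" for T :: "'a set" using card_mono[of UNIV T] card_F by simp
  have split: "q = p ^ (d - c) * p ^ c" if "p ^ c \<le> q" for c
  proof -
    have "c \<le> d" using that p_gt_1 by (simp add: q_eq)
    then show ?thesis by (simp add: q_eq flip: power_add)
  qed
  have pos: "p ^ c > 0" for c using p_gt_1 by simp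
  show count1: "2 * num_components orbit_graph = HK_order p G P * e_num p G P * p ^ (d - c1)"
    if "P \<noteq> uminus ` P"
  proof -
    have "card flag_set = num_components orbit_graph * (2 * p ^ c1)"
      using flags.card_verts_eq_num_components_times[of "2 * p ^ c1"]
        card_component_asymmetric[OF that] c1 by simp
    moreover have "card flag_set = p ^ (d - c1) * p ^ c1 * (HK_order p G P * e_num p G P)"
      using split[of c1] le[of "T1_tilde P"] c1 by (simp add: card_flag_set card_blocks)
    ultimately have "(2 * num_components orbit_graph) * p ^ c1 =
        (HK_order p G P * e_num p G P * p ^ (d - c1)) * p ^ c1"
      by (simp only: mult_ac)
    then show ?thesis using pos[of c1] by (metis mult_right_cancel less_numeral_extra(3))
  qed
  show "num_components orbit_graph = HK_order p G P * e_num p G P * p ^ (d - c2)" if "P = uminus ` P"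
  proof -
    have "card flag_set = num_components orbit_graph * p ^ c2"
      using flags.card_verts_eq_num_components_times[of "p ^ c2"]
        card_component_symmetric[OF that] c2 by simp
    moreover have "card flag_set = p ^ (d - c2) * p ^ c2 * (HK_order p G P * e_num p G P)"
      using split[of c2] le[of "T2_tilde P"] c2 by (simp add: card_flag_set card_blocks)
    ultimately have "num_components orbit_graph * p ^ c2 =
        (HK_order p G P * e_num p G P * p ^ (d - c2)) * p ^ c2"
      by (simp only: mult_ac)
    then show ?thesis using pos[of c2] by (metis mult_right_cancel less_numeral_extra(3))
  qed
  have conn: "P \<noteq> uminus ` P \<and> card blocks = 2 \<and> card (T1_tilde P) = q"
    if "Digraph_Component.connected orbit_graph"
  proof -
    have "P \<noteq> uminus ` P"
    proof
      assume sym: "P = uminus ` P"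
      have "card (T2_tilde P) = card flag_set"
        using flags.connected_iff_card[of "card (T2_tilde P)"] card_component_symmetric[OF sym]
          that flag_set_nonempty by simp
      moreover have "q * 2 \<le> card flag_set" using two_le_card_blocks[OF assms(2)] by (simp add: card_flag_set)
      ultimately show False using le[of "T2_tilde P"] q_gt_1 by simp
    qed
    moreover from this have eq: "2 * card (T1_tilde P) = q * card blocks"
      using flags.connected_iff_card[of "2 * card (T1_tilde P)"] card_component_asymmetric
        that flag_set_nonempty by (simp add: card_flag_set)
    moreover have "card blocks = 2"
    proof -
      have "q * card blocks \<le> q * 2" using eq le[of "T1_tilde P"] by linarith
      then have "card blocks \<le> 2" using q_gt_1 by (simp only: mult_le_cancel1)
      then show ?thesis using two_le_card_blocks[OF assms(2)] by simp
    qed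
    ultimately show ?thesis by simp
  qed
  have half_iff: "q - 1 = 2 * card P \<longleftrightarrow> card blocks = 2"
    using card_blocks_times_card_P assms(1) by (metis mult_right_cancel not_less_zero)
  show "card flag_set = 2 * q \<and> q - 1 = 2 * card P" if "Digraph_Component.connected orbit_graph"
    using conn[OF that] half_iff by (simp add: card_flag_set)
  show "Digraph_Component.connected orbit_graph \<longleftrightarrow>
      [int p = - 1] (mod 4) \<and> odd d \<and> subgroup P (Fq_mult :: 'a monoid) \<and>
      card (rcosets\<^bsub>Fq_mult\<^esub> P) = 2"
  proof
    assume "Digraph_Component.connected orbit_graph"
    then show "[int p = - 1] (mod 4) \<and> odd d \<and> subgroup P (Fq_mult :: 'a monoid) \<and>
        card (rcosets\<^bsub>Fq_mult\<^esub> P) = 2"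
      using conn half_iff half_block_imp by blast
  next
    assume R: "[int p = - 1] (mod 4) \<and> odd d \<and> subgroup P (Fq_mult :: 'a monoid) \<and>
        card (rcosets\<^bsub>Fq_mult\<^esub> P) = 2"
    then have half: "q - 1 = 2 * card P" using index_of_subgroup by metis
    have "P \<noteq> uminus ` P" using half_subgroup_imp_asymmetric half R by blast
    then show "Digraph_Component.connected orbit_graph"
      using flags.connected_iff_card[of "2 * card (T1_tilde P)"] card_component_asymmetric
        card_T1_tilde_half[OF half assms(1) c1] flag_set_nonempty half half_iff
      by (simp add: card_flag_set)
  qed
qed

end

theorem lemma4p9:
  fixes G :: "('a::{field,finite} \<Rightarrow> 'a) set"
    and P L :: "'a set"
    and D :: "'a incidence_structure"
    and \<Omega> :: "('a \<times> 'a set) set"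
    and \<Gamma> :: "('a \<times> 'a set, ('a \<times> 'a set) \<times> ('a \<times> 'a set)) pre_digraph"
    and p d q c1 c2 :: nat
  assumes "Factorial_Ring.prime p" and "q = p ^ d" and "card (UNIV :: 'a set) = q"
    and "subgroup G AGammaL1" and "two_transitive G"
    and "imprimitive_block (stab0 G) P" and "1 \<in> P"
    and "L = P \<union> {0}" and "\<not> subfield L Fq"
    and "D = orbit_design G L" and "\<Omega> = flag_orbit G (0, L)"
    and "\<Gamma> = flag_graph D \<Omega> (Xi \<Omega>)"
    and "1 < card P" and "card P < q - 1"
    and "card (translation_maps (T1_tilde P)) = p ^ c1"
    and "card (translation_maps (T2_tilde P)) = p ^ c2"
  shows "(P \<noteq> uminus ` P \<longrightarrow>
            real (num_components \<Gamma>) = real (HK_order p G P * e_num p G P * p ^ (d - c1)) / 2)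
       \<and> (P = uminus ` P \<longrightarrow>
            num_components \<Gamma> = HK_order p G P * e_num p G P * p ^ (d - c2))
       \<and> (Digraph_Component.connected \<Gamma> \<longleftrightarrow>
            [int p = - 1] (mod 4) \<and> odd d \<and>
            subgroup P Fq_mult \<and> card (rcosets\<^bsub>Fq_mult\<^esub> P) = 2)
       \<and> (Digraph_Component.connected \<Gamma> \<longrightarrow>
            card (verts \<Gamma>) = card \<Omega> \<and> card \<Omega> = 2 * q \<and> has_valency \<Gamma> ((real q - 1) / 2))"
proof -
  interpret affine_block "TYPE('a)" p d q G P
    using assms by (intro affine_block.intro galois_field.intro affine_block_axioms.intro)
  have \<Omega>: "\<Omega> = flag_set" using assms(8,11) by (simp add: flag_set_def)
  then have \<Gamma>: "\<Gamma> = orbit_graph" using assms(12) by (simp add: flag_graph_def orbit_graph_def)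
  note res = components_and_connectedness[OF assms(13,14), of c1 c2]
  have c: "card (T1_tilde P) = p ^ c1" "card (T2_tilde P) = p ^ c2"
    using assms(15,16) by (simp_all add: card_translation_maps)
  have "real (num_components \<Gamma>) = real (HK_order p G P * e_num p G P * p ^ (d - c1)) / 2"
    if "P \<noteq> uminus ` P"
    unfolding \<Gamma> res(1)[OF c that, symmetric] by simp
  moreover have "has_valency \<Gamma> ((real q - 1) / 2)" if "Digraph_Component.connected \<Gamma>"
  proof -
    have "q - 1 = 2 * card P" using res(4)[OF c] that \<Gamma> by blast
    then have "real q = 2 * real (card P) + 1" using q_gt_1 by linarith
    then show ?thesis using valency_orbit_graph by (simp add: has_valency_def \<Gamma>)
  qed
  ultimately show ?thesis
    using res(2-4)[OF c] by (simp add: \<Gamma> \<Omega>)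
qed

end
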